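(* For every $p\in[0,1/2)$ and every $\epsilon>0$, two deterministic $p$-faulty agents in the wireless model can solve probabilistically disoriented linear search with parameter $p$ with competitive ratio $3+4\sqrt{p(1-p)}+\epsilon$.
   Context: Two agents start at the origin of the real line and move at speed at most $1$ independently of each other (each may also slow down or halt). A hidden target is at an unknown point $x\in\mathbb{R}$ and is detected when an agent walks over it; the origin is also distinguishable. Each agent is $p$-faulty: every attempt to change direction fails independently (and independently of the other agent) with probability $p$, in which case it keeps moving in the same direction, and the agent is not informed of the outcome. Initially agents start moving in chosen directions without fault. Agents detect when they meet; a meeting agent can serve as a distinguished point for the other, and an agent moving in some direction can pick up another agent it meets so that both continue in that direction with probability $1$. In the wireless model the agents can exchange messages instantaneously at any time. Deterministic agents have no random oracle. If $E(x)$ is the expected time at which the last agent reaches target $x$, the competitive ratio is $\limsup_{|x|\to\infty}E(x)/|x|$. *)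

theory Defs
  imports "HOL-Probability.Probability"
begin

datatype agent = Agent1 | Agent2

fun other :: "agent \<Rightarrow> agent" where
  "other Agent1 = Agent2"
| "other Agent2 = Agent1"

text \<open>
  What the agents can sense: an agent standing on the origin or on the target, and the two agents
  standing at the same point. Headings and outcomes of turn attempts are never sensed.
\<close>

datatype contact = AtOrigin agent | AtTarget agent | Together

definition contacts :: "real \<Rightarrow> (agent \<Rightarrow> real) \<Rightarrow> contact set" where
  "contacts x pos =
     {AtOrigin a |a. pos a = 0} \<union> {AtTarget a |a. pos a = x} \<union>
     {Together |a. pos a = pos (other a)}"

text \<open>
  A run is a sequence of phases. At the start of a phase each agent keeps its heading, attempts to
  turn, or is picked up by the other agent; it then moves along its (possibly unknown) heading,
  having covered distance \<open>progress a s\<close> at time \<open>s\<close> of the phase.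
  The validity condition on \<open>progress\<close> says that the speed is always between \<open>0\<close> and \<open>1\<close>.
\<close>

datatype action = Keep | Turn | PickedUp

record command =
  duration :: real
  action :: "agent \<Rightarrow> action"
  progress :: "agent \<Rightarrow> real \<Rightarrow> real"

definition valid_command :: "command \<Rightarrow> bool" where
  "valid_command c \<longleftrightarrow> duration c > 0 \<and>
     (\<forall>a. progress c a 0 = 0 \<and>
       (\<forall>s t. 0 \<le> s \<and> s \<le> t \<and> t \<le> duration c \<longrightarrow>
          0 \<le> progress c a t - progress c a s \<and> progress c a t - progress c a s \<le> t - s))"

text \<open>
  The history, latest entry first, lists the clock time and the contacts at the start of every
  phase so far. Since the agents exchange messages instantaneously, the commands of both agents may
  depend on everything sensed by either of them; past commands need not be recorded because
  \<open>decide\<close> is deterministic. Headings are \<open>1\<close> (right) and \<open>-1\<close> (left).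
\<close>

type_synonym history = "(real \<times> contact set) list"

record algorithm =
  start :: "agent \<Rightarrow> real"
  decide :: "history \<Rightarrow> command"

definition valid_algorithm :: "algorithm \<Rightarrow> bool" where
  "valid_algorithm alg \<longleftrightarrow> (\<forall>a. start alg a \<in> {-1, 1}) \<and> (\<forall>h. valid_command (decide alg h))"

text \<open>
  The Boolean of an agent is true iff its turn attempt (if any) at the start of the phase fails.
  An agent can only be picked up by an agent at the same point that keeps its own heading.
\<close>

fun fault :: "bool \<times> bool \<Rightarrow> agent \<Rightarrow> bool" where
  "fault (u, v) Agent1 = u"
| "fault (u, v) Agent2 = v"

definition new_heading ::
  "command \<Rightarrow> bool \<times> bool \<Rightarrow> (agent \<Rightarrow> real) \<Rightarrow> (agent \<Rightarrow> real) \<Rightarrow> agent \<Rightarrow> real" where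
  "new_heading c w pos dir a =
     (case action c a of
        Keep \<Rightarrow> dir a
      | Turn \<Rightarrow> (if fault w a then dir a else - dir a)
      | PickedUp \<Rightarrow>
          (if pos a = pos (other a) \<and> action c (other a) = Keep then dir (other a) else dir a))"

definition moved ::
  "command \<Rightarrow> (agent \<Rightarrow> real) \<Rightarrow> (agent \<Rightarrow> real) \<Rightarrow> real \<Rightarrow> agent \<Rightarrow> real" where
  "moved c pos dir s a = pos a + dir a * progress c a s"

text \<open>
  A phase lasts for the commanded duration, unless it is interrupted earlier by a contact that was
  not present at its start. The set of interrupting times is closed, so the infimum is attained.
\<close>

definition phase_length ::
  "real \<Rightarrow> command \<Rightarrow> (agent \<Rightarrow> real) \<Rightarrow> (agent \<Rightarrow> real) \<Rightarrow> real" where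
  "phase_length x c pos dir =
     Inf (insert (duration c)
       {s \<in> {0..duration c}. \<not> contacts x (moved c pos dir s) \<subseteq> contacts x pos})"

record config =
  clock :: real
  position :: "agent \<Rightarrow> real"
  heading :: "agent \<Rightarrow> real"
  past :: history

definition initial :: "algorithm \<Rightarrow> real \<Rightarrow> config" where
  "initial alg x =
     \<lparr>clock = 0, position = (\<lambda>_. 0), heading = start alg, past = [(0, contacts x (\<lambda>_. 0))]\<rparr>"

definition step :: "algorithm \<Rightarrow> real \<Rightarrow> bool \<times> bool \<Rightarrow> config \<Rightarrow> config" where
  "step alg x w S =
     (let c = decide alg (past S);
          dir = new_heading c w (position S) (heading S);
          l = phase_length x c (position S) dir;
          pos = moved c (position S) dir l;
          t = clock S + l
      in \<lparr>clock = t, position = pos, heading = dir, past = (t, contacts x pos) # past S\<rparr>)"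

primrec run :: "algorithm \<Rightarrow> real \<Rightarrow> (bool \<times> bool) stream \<Rightarrow> nat \<Rightarrow> config" where
  "run alg x \<omega> 0 = initial alg x"
| "run alg x \<omega> (Suc k) = step alg x (\<omega> !! k) (run alg x \<omega> k)"

text \<open>
  Each phase has a fresh pair of coins, used only by agents that attempt a turn; as decisions depend
  on earlier coins only, the attempts fail independently with probability \<open>p\<close>.
\<close>

definition coins :: "real \<Rightarrow> (bool \<times> bool) stream measure" where
  "coins p = stream_space (measure_pmf (pair_pmf (bernoulli_pmf p) (bernoulli_pmf p)))"

text \<open>
  An agent's first visit to the target interrupts the phase in which it happens, so it suffices to
  inspect the positions at phase boundaries. The time is \<open>\<infinity>\<close> if there is no visit.
\<close>

definition arrival_time :: "algorithm \<Rightarrow> real \<Rightarrow> (bool \<times> bool) stream \<Rightarrow> agent \<Rightarrow> ennreal" where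
  "arrival_time alg x \<omega> a =
     (INF k \<in> {k. position (run alg x \<omega> k) a = x}. ennreal (clock (run alg x \<omega> k)))"

definition search_time :: "algorithm \<Rightarrow> real \<Rightarrow> (bool \<times> bool) stream \<Rightarrow> ennreal" where
  "search_time alg x \<omega> = max (arrival_time alg x \<omega> Agent1) (arrival_time alg x \<omega> Agent2)"

definition solves_search :: "real \<Rightarrow> algorithm \<Rightarrow> bool" where
  "solves_search p alg \<longleftrightarrow> (\<forall>x. AE \<omega> in coins p. search_time alg x \<omega> < \<infinity>)"

definition expected_search_time :: "real \<Rightarrow> algorithm \<Rightarrow> real \<Rightarrow> ennreal" where
  "expected_search_time p alg x = (\<integral>\<^sup>+ \<omega>. search_time alg x \<omega> \<partial>coins p)"

definition competitive_ratio :: "real \<Rightarrow> algorithm \<Rightarrow> ennreal" where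
  "competitive_ratio p alg =
     Limsup at_infinity (\<lambda>x. expected_search_time p alg x / ennreal \<bar>x\<bar>)"

lemma measurable_run: "(\<lambda>\<omega>. run alg x \<omega> k) \<in> measurable (coins p) (count_space UNIV)"
proof (induction k)
  case (Suc k)
  have 1: "(\<lambda>\<omega>. \<omega> !! k) \<in> measurable (coins p) (count_space UNIV)"
    unfolding coins_def
    by (rule measurable_compose[OF measurable_snth]) auto
  have 2: "(\<lambda>\<omega>. step alg x w (run alg x \<omega> k)) \<in> measurable (coins p) (count_space UNIV)" for w
    by (rule measurable_compose[OF Suc]) simp
  show ?case
    using measurable_compose_countable[OF 2 1] by simp
qed simp

lemma measurable_search_time: "search_time alg x \<in> borel_measurable (coins p)"
proof -
  have arr: "arrival_time alg x \<omega> a =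
      (INF k. if position (run alg x \<omega> k) a = x then ennreal (clock (run alg x \<omega> k)) else \<infinity>)"
    (is "_ = (INF k. ?f k)") for \<omega> a
  proof (rule antisym)
    show "arrival_time alg x \<omega> a \<le> (INF k. ?f k)"
      unfolding arrival_time_def by (rule INF_greatest) (auto intro: INF_lower)
    show "(INF k. ?f k) \<le> arrival_time alg x \<omega> a"
      unfolding arrival_time_def
    proof (rule INF_greatest)
      fix k assume "k \<in> {k. position (run alg x \<omega> k) a = x}"
      then show "(INF k. ?f k) \<le> ennreal (clock (run alg x \<omega> k))"
        by (intro INF_lower2[where i = k]) auto
    qed
  qed
  have "(\<lambda>\<omega>. arrival_time alg x \<omega> a) \<in> borel_measurable (coins p)" for a
    unfolding arr
    by (intro borel_measurable_INF measurable_compose[OF measurable_run]) auto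
  then show ?thesis
    unfolding search_time_def[abs_def] by measurable
qed

end

theory Submission
  imports Defs
begin

text \<open>
  For \<open>p \<le> 0.32\<close> the agents walk in opposite directions until one of them finds the target. The
  other one attempts to turn and walks as far as it is away from the origin; if it has not met the
  origin, it repeats this with twice the distance. The expected cost satisfies
  \<open>g = 1 + 2 * p * g\<close>, and the competitive ratio \<open>2 + 1 / (1 - 2 * p)\<close> is small enough.

  For larger \<open>p\<close> the agents stay close together and so turn reliably at a cost that is small compared
  to the distance walked: an agent whose attempt fails remains with the other one and can try again, and
  after a success it waits for its partner. They imitate the randomized zigzag of Kao, Reif and Tate
  with competitive ratio about \<open>4.6\<close> (here \<open>4.81\<close>, which is less than
  \<open>3 + 4 * sqrt (p * (1 - p))\<close>), taking the random bits from the faults of the first turns.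
\<close>

section \<open>Bounding the expected search time by a potential\<close>

text \<open>Two algorithms are needed because \<open>3 + 4 * sqrt (p * (1 - p))\<close> stays below
  5, while \<open>2 + 1 / (1 - 2 * p)\<close> is unbounded as \<open>p\<close> tends to 1/2; the
  zigzag in turn draws its random bits from faults and needs \<open>p > 0\<close>. At
  \<open>p = 0.32\<close> the first ratio is about 4.78 and the target ratio about 4.866. Origin of
  4.81: an ideal randomized zigzag with expansion factor r has ratio 1 + (1 + r) / ln r, which is
  about 4.594 for r = \<open>(27/25)^16\<close>, roughly 3.43 (the optimum is near 3.59). Using 32
  discrete scales replaces ln r by 16 * 2/27 and gives about 4.73. Turning overhead raises the cost
  of a level from 2 to 2.02 radii, hence 4.78. The imperfect uniformity of the random bits adds
  0.014. The cost of collecting them does not depend on the target and is absorbed for large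
  distances. The zigzag plan never tests for the target. An agent that passes it alone merely has
  its phase interrupted, and the analysis waits until the pair stands there jointly.\<close>

definition found :: "real \<Rightarrow> config \<Rightarrow> bool" where
  "found x S \<longleftrightarrow> (\<forall>a. position S a = x)"

text \<open>Consumes the coins from the head of the stream and allows any starting configuration, so
  that recursion on runs matches integrating out the first coin pair.\<close>

primrec run_from :: "algorithm \<Rightarrow> real \<Rightarrow> nat \<Rightarrow> config \<Rightarrow> (bool \<times> bool) stream \<Rightarrow> config" where
  "run_from alg x 0 S \<omega> = S"
| "run_from alg x (Suc k) S \<omega> = run_from alg x k (step alg x (shd \<omega>) S) (stl \<omega>)"

lemma run_from_Suc: "run_from alg x (Suc k) S \<omega> = step alg x (\<omega> !! k) (run_from alg x k S \<omega>)"
  by (induction k arbitrary: S \<omega>) auto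

lemma run_eq_run_from: "run alg x \<omega> k = run_from alg x k (initial alg x) \<omega>"
  by (induction k) (simp_all add: run_from_Suc del: run_from.simps(2))

text \<open>
  The time until \<open>found\<close>, cut off after \<open>k\<close> phases, where every phase is charged \<open>c\<close> on top of
  its length. The surcharge makes the limit infinite on runs that never find the target.
\<close>

primrec cost :: "algorithm \<Rightarrow> real \<Rightarrow> real \<Rightarrow> nat \<Rightarrow> config \<Rightarrow> (bool \<times> bool) stream \<Rightarrow> ennreal" where
  "cost alg x c 0 S \<omega> = 0"
| "cost alg x c (Suc k) S \<omega> =
     (if found x S then 0
      else ennreal (clock (step alg x (shd \<omega>) S) - clock S + c) +
        cost alg x c k (step alg x (shd \<omega>) S) (stl \<omega>))"

lemma phase_length_nonneg:
  assumes "valid_command c"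
  shows "0 \<le> phase_length x c pos dir"
  using assms unfolding phase_length_def valid_command_def
  by (intro cInf_greatest) auto

lemma clock_step_ge:
  assumes "valid_algorithm alg"
  shows "clock S \<le> clock (step alg x w S)"
  using assms phase_length_nonneg by (auto simp: step_def Let_def valid_algorithm_def)

lemma cost_mono: "cost alg x c k S \<omega> \<le> cost alg x c (Suc k) S \<omega>"
proof (induction k arbitrary: S \<omega>)
  case (Suc k)
  then show ?case
    by (subst (1 2) cost.simps) (auto intro!: add_left_mono simp del: cost.simps)
qed simp

text \<open>The witness is the first phase boundary at which both agents are at the target:
  \<open>cost\<close> stops counting there, even if \<open>k\<close> is larger.\<close>

lemma cost_ge_clock:
  assumes "valid_algorithm alg" "0 \<le> c" "0 \<le> clock S" "found x (run_from alg x k S \<omega>)"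
  shows "\<exists>j. found x (run_from alg x j S \<omega>) \<and>
    ennreal (clock (run_from alg x j S \<omega>)) \<le> ennreal (clock S) + cost alg x c k S \<omega>"
  using assms(3,4)
proof (induction k arbitrary: S \<omega>)
  case 0
  then show ?case by (intro exI[of _ 0]) auto
next
  case (Suc k)
  show ?case
  proof (cases "found x S")
    case True
    then show ?thesis by (intro exI[of _ 0]) auto
  next
    case False
    let ?S = "step alg x (shd \<omega>) S"
    have le: "clock S \<le> clock ?S" by (rule clock_step_ge[OF assms(1)])
    then obtain j where j: "found x (run_from alg x j ?S (stl \<omega>))"
      "ennreal (clock (run_from alg x j ?S (stl \<omega>))) \<le> ennreal (clock ?S) + cost alg x c k ?S (stl \<omega>)"
      using Suc.IH[of ?S "stl \<omega>"] Suc.prems by auto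
    have "ennreal (clock ?S) \<le> ennreal (clock S) + ennreal (clock ?S - clock S + c)"
      using le Suc.prems assms(2) by (subst ennreal_plus[symmetric]) (auto intro!: ennreal_leI)
    then have "ennreal (clock ?S) + cost alg x c k ?S (stl \<omega>) \<le> ennreal (clock S) + cost alg x c (Suc k) S \<omega>"
      using False by (simp add: add_right_mono flip: add.assoc)
    with j show ?thesis by (intro exI[of _ "Suc j"]) auto
  qed
qed

lemma cost_ge_steps:
  assumes "valid_algorithm alg" "0 \<le> c" "\<And>k. \<not> found x (run_from alg x k S \<omega>)"
  shows "ennreal (real k * c) \<le> cost alg x c k S \<omega>"
  using assms(3)
proof (induction k arbitrary: S \<omega>)
  case (Suc k)
  let ?S = "step alg x (shd \<omega>) S"
  have nf: "\<not> found x S" using Suc.prems[of 0] by simp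
  have "ennreal (real k * c) \<le> cost alg x c k ?S (stl \<omega>)"
    using Suc.prems[of "Suc k" for k] by (intro Suc.IH) simp
  moreover have "ennreal c \<le> ennreal (clock ?S - clock S + c)"
    using clock_step_ge[OF assms(1), of S x "shd \<omega>"] by (intro ennreal_leI) simp
  ultimately have "ennreal c + ennreal (real k * c) \<le> cost alg x c (Suc k) S \<omega>"
    using nf by (simp add: add_mono)
  moreover have "ennreal (real (Suc k) * c) = ennreal c + ennreal (real k * c)"
    using assms(2) by (subst ennreal_plus[symmetric]) (auto simp: algebra_simps)
  ultimately show ?case by simp
qed simp

lemma arrival_time_le:
  "position (run alg x \<omega> k) a = x \<Longrightarrow> arrival_time alg x \<omega> a \<le> ennreal (clock (run alg x \<omega> k))"
  unfolding arrival_time_def by (intro INF_lower) auto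

text \<open>Joint presence at the target implies that each agent has visited it, so its time bounds
  both arrival times. On runs without joint presence the accumulated surcharges make the right-hand
  side infinite.\<close>

lemma search_time_le_cost:
  assumes "valid_algorithm alg" "0 < c"
  shows "search_time alg x \<omega> \<le> (SUP k. cost alg x c k (initial alg x) \<omega>)"
proof (cases "\<exists>k. found x (run_from alg x k (initial alg x) \<omega>)")
  case True
  then obtain k where k: "found x (run_from alg x k (initial alg x) \<omega>)" by blast
  have 0: "clock (initial alg x) = 0" by (simp add: initial_def)
  obtain j where *: "found x (run_from alg x j (initial alg x) \<omega>)"
    "ennreal (clock (run_from alg x j (initial alg x) \<omega>)) \<le> cost alg x c k (initial alg x) \<omega>"
    using cost_ge_clock[OF assms(1) less_imp_le[OF assms(2)] _ k] unfolding 0 by auto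
  have "search_time alg x \<omega> \<le> ennreal (clock (run alg x \<omega> j))"
    using *(1) arrival_time_le[of alg x \<omega> j]
    by (simp add: search_time_def found_def flip: run_eq_run_from)
  also have "\<dots> \<le> cost alg x c k (initial alg x) \<omega>" using *(2) by (simp add: run_eq_run_from)
  also have "\<dots> \<le> (SUP k. cost alg x c k (initial alg x) \<omega>)" by (intro SUP_upper) auto
  finally show ?thesis .
next
  case False
  have "(SUP k. cost alg x c k (initial alg x) \<omega>) = top"
  proof (rule ennreal_SUP_eq_top)
    fix n
    obtain k :: nat where "real n / c < real k" using reals_Archimedean2 by blast
    then have "real n \<le> real k * c" using assms(2) by (simp add: field_simps)
    then have "of_nat n \<le> ennreal (real k * c)"
      by (metis ennreal_leI ennreal_of_nat_eq_real_of_nat)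
    also have "\<dots> \<le> cost alg x c k (initial alg x) \<omega>"
      using False assms by (intro cost_ge_steps) auto
    finally show "\<exists>k\<in>UNIV. of_nat n \<le> cost alg x c k (initial alg x) \<omega>" by blast
  qed
  then show ?thesis by (metis top_greatest)
qed

lemma measurable_cost: "cost alg x c k S \<in> borel_measurable (coins p)"
proof (induction k arbitrary: S)
  case 0
  then show ?case by simp
next
  case (Suc k)
  have hd: "shd \<in> measurable (coins p) (count_space UNIV)"
    unfolding coins_def by (rule measurable_compose[OF measurable_shd]) auto
  have tl: "stl \<in> measurable (coins p) (coins p)" unfolding coins_def by (rule measurable_stl)
  have "(\<lambda>\<omega>. if found x S then 0
        else ennreal (clock (step alg x w S) - clock S + c) +
          cost alg x c k (step alg x w S) (stl \<omega>)) \<in> borel_measurable (coins p)" for w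
    using measurable_compose[OF tl Suc] by measurable
  from measurable_compose_countable[OF this hd] show ?case by simp
qed

lemma nn_integral_coin_pair:
  assumes "0 \<le> p" "p \<le> 1"
  shows "(\<integral>\<^sup>+ w. f (fault w a) \<partial>measure_pmf (pair_pmf (bernoulli_pmf p) (bernoulli_pmf p))) =
    ennreal p * f True + ennreal (1 - p) * f False"
proof -
  have b: "(\<integral>\<^sup>+ u. f u \<partial>measure_pmf (bernoulli_pmf p)) = ennreal p * f True + ennreal (1 - p) * f False"
    using assms by (simp add: nn_integral_measure_pmf nn_integral_count_space_finite UNIV_bool
        add.commute)
  show ?thesis
    by (cases a) (auto simp: nn_integral_pair_pmf' b)
qed

text \<open>A supermartingale condition: \<open>v\<close> pays for the phase, its surcharge and the
  expected new potential. One agent's coin suffices because no phase of either algorithm lets both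
  agents attempt a turn.\<close>

definition potential_step ::
  "real \<Rightarrow> real \<Rightarrow> algorithm \<Rightarrow> real \<Rightarrow> (config \<Rightarrow> real \<Rightarrow> bool) \<Rightarrow> config \<Rightarrow> real \<Rightarrow> bool" where
  "potential_step p c alg x G S v \<longleftrightarrow>
     (\<exists>a l v'. (\<forall>w. clock (step alg x w S) - clock S \<le> l (fault w a) \<and>
          (found x (step alg x w S) \<or> G (step alg x w S) (v' (fault w a)))) \<and>
        0 \<le> v' True \<and> 0 \<le> v' False \<and>
        p * (l True + c + v' True) + (1 - p) * (l False + c + v' False) \<le> v)"

lemma potential_stepI:
  assumes "\<And>w. clock (step alg x w S) - clock S \<le> l (fault w a)"
    and "\<And>w. found x (step alg x w S) \<or> G (step alg x w S) (v' (fault w a))"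
    and "0 \<le> v' True" "0 \<le> v' False"
    and "p * (l True + c + v' True) + (1 - p) * (l False + c + v' False) \<le> v"
  shows "potential_step p c alg x G S v"
  using assms unfolding potential_step_def by blast

lemma potential_step_constI:
  assumes "\<And>w. clock (step alg x w S) - clock S \<le> l"
    and "\<And>w. found x (step alg x w S) \<or> G (step alg x w S) v'"
    and "0 \<le> v'" "l + c + v' \<le> v"
  shows "potential_step p c alg x G S v"
  using assms
  by (intro potential_stepI[where l = "\<lambda>_. l" and v' = "\<lambda>_. v'"]) (auto simp: algebra_simps)

text \<open>After the first coin pair the tail of the stream is again distributed as
  \<open>coins p\<close>, so the run restarts from the new configuration and induction on the number
  of phases applies.\<close>

lemma nn_integral_cost_le:
  assumes p: "0 \<le> p" "p \<le> 1" and c: "0 \<le> c"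
    and valid: "valid_algorithm alg"
    and G: "\<And>S v. G S v \<Longrightarrow> \<not> found x S \<Longrightarrow>
      potential_step p c alg x G S v"
    and S: "found x S \<or> G S v" and v: "0 \<le> v"
  shows "(\<integral>\<^sup>+ \<omega>. cost alg x c k S \<omega> \<partial>coins p) \<le> ennreal v"
  using S v
proof (induction k arbitrary: S v)
  case (Suc k)
  let ?D = "pair_pmf (bernoulli_pmf p) (bernoulli_pmf p)"
  interpret C: prob_space "coins p"
    unfolding coins_def by (rule prob_space.prob_space_stream_space[OF prob_space_measure_pmf])
  show ?case
  proof (cases "found x S")
    case False
    then have "G S v" using Suc.prems by simp
    from G[OF this False, unfolded potential_step_def] obtain a l v' where
      1: "\<And>w. clock (step alg x w S) - clock S \<le> l (fault w a)" and
      2: "\<And>w. found x (step alg x w S) \<or> G (step alg x w S) (v' (fault w a))" and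
      3: "0 \<le> v' True" "0 \<le> v' False" and
      4: "p * (l True + c + v' True) + (1 - p) * (l False + c + v' False) \<le> v"
      by blast
    have v': "0 \<le> v' b" for b using 3 by (cases b) auto
    have l: "0 \<le> l b" for b
    proof -
      have "\<exists>w. fault w a = b" by (cases a) (auto intro: exI[of _ "(b, b)"])
      then obtain w where "fault w a = b" by blast
      with 1[of w] clock_step_ge[OF valid, of S x w] show ?thesis by simp
    qed
    have "(\<integral>\<^sup>+ \<omega>. cost alg x c (Suc k) S \<omega> \<partial>coins p) =
        (\<integral>\<^sup>+ w. (\<integral>\<^sup>+ \<omega>. cost alg x c (Suc k) S (w ## \<omega>) \<partial>coins p) \<partial>?D)"
      unfolding coins_def
      by (rule prob_space.nn_integral_stream_space[OF prob_space_measure_pmf]) (use measurable_cost[unfolded coins_def] in blast)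
    also have "\<dots> = (\<integral>\<^sup>+ w. ennreal (clock (step alg x w S) - clock S + c) +
        (\<integral>\<^sup>+ \<omega>. cost alg x c k (step alg x w S) \<omega> \<partial>coins p) \<partial>?D)"
      using False
      by (intro nn_integral_cong)
        (simp add: nn_integral_add measurable_cost C.emeasure_space_1)
    also have "\<dots> \<le> (\<integral>\<^sup>+ w. ennreal (l (fault w a) + c + v' (fault w a)) \<partial>?D)"
    proof (intro nn_integral_mono)
      fix w
      have "ennreal (clock (step alg x w S) - clock S + c) +
          (\<integral>\<^sup>+ \<omega>. cost alg x c k (step alg x w S) \<omega> \<partial>coins p)
        \<le> ennreal (l (fault w a) + c) + ennreal (v' (fault w a))"
        using 1[of w] by (intro add_mono Suc.IH 2 v' ennreal_leI) auto
      then show "ennreal (clock (step alg x w S) - clock S + c) +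
          (\<integral>\<^sup>+ \<omega>. cost alg x c k (step alg x w S) \<omega> \<partial>coins p)
        \<le> ennreal (l (fault w a) + c + v' (fault w a))"
        using c l v' by (simp add: ennreal_plus)
    qed
    also have "\<dots> = ennreal (p * (l True + c + v' True) + (1 - p) * (l False + c + v' False))"
      using p c l v'
      by (subst nn_integral_coin_pair[where f = "\<lambda>b. ennreal (l b + c + v' b)"])
        (auto simp: ennreal_plus ennreal_mult)
    also have "\<dots> \<le> ennreal v" using 4 by (rule ennreal_leI)
    finally show ?thesis .
  qed simp
next
  case 0
  then show ?case by (simp add: cost.simps(1)[abs_def])
qed

theorem expected_search_time_le:
  assumes "0 \<le> p" "p \<le> 1" and c: "0 < c"
    and valid: "valid_algorithm alg"
    and "\<And>S v. G S v \<Longrightarrow> \<not> found x S \<Longrightarrow>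
      potential_step p c alg x G S v"
    and "found x (initial alg x) \<or> G (initial alg x) v" and "0 \<le> v"
  shows "expected_search_time p alg x \<le> ennreal v"
proof -
  have "expected_search_time p alg x \<le> (\<integral>\<^sup>+ \<omega>. (SUP k. cost alg x c k (initial alg x) \<omega>) \<partial>coins p)"
    unfolding expected_search_time_def by (intro nn_integral_mono search_time_le_cost valid c)
  also have "\<dots> = (SUP k. \<integral>\<^sup>+ \<omega>. cost alg x c k (initial alg x) \<omega> \<partial>coins p)"
    by (intro nn_integral_monotone_convergence_SUP measurable_cost incseq_SucI le_funI cost_mono)
  also have "\<dots> \<le> ennreal v"
    using assms less_imp_le[OF c] by (intro SUP_least nn_integral_cost_le[where G = G]) auto
  finally show ?thesis .
qed

lemma solves_searchI:
  assumes "\<And>x. expected_search_time p alg x < \<infinity>"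
  shows "solves_search p alg"
  unfolding solves_search_def
proof
  fix x
  have "AE \<omega> in coins p. search_time alg x \<omega> \<noteq> \<infinity>"
    using assms[of x] unfolding expected_search_time_def
    by (intro nn_integral_PInf_AE measurable_search_time) auto
  then show "AE \<omega> in coins p. search_time alg x \<omega> < \<infinity>"
    by (simp add: less_top)
qed

lemma competitive_ratio_leI:
  assumes "\<And>x. b \<le> \<bar>x\<bar> \<Longrightarrow> expected_search_time p alg x \<le> ennreal (r * \<bar>x\<bar>)"
  shows "competitive_ratio p alg \<le> ennreal r"
  unfolding competitive_ratio_def
proof (rule Limsup_bounded)
  have "expected_search_time p alg x / ennreal \<bar>x\<bar> \<le> ennreal r" if "max 1 b \<le> norm x" for x
  proof -
    have "expected_search_time p alg x / ennreal \<bar>x\<bar> \<le> ennreal (r * \<bar>x\<bar>) / ennreal \<bar>x\<bar>"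
      using that by (intro divide_right_mono_ennreal assms) auto
    also have "\<dots> = ennreal r"
      using that by (cases "0 \<le> r") (auto simp: divide_ennreal ennreal_neg mult_nonpos_nonneg)
    finally show ?thesis .
  qed
  then show "\<forall>\<^sub>F x in at_infinity. expected_search_time p alg x / ennreal \<bar>x\<bar> \<le> ennreal r"
    unfolding eventually_at_infinity by blast
qed

section \<open>Walking at full speed\<close>

text \<open>The duration 1 for nonpositive \<open>d\<close> is a default that makes the command
  valid on every history, including those that never occur.\<close>

definition walk :: "real \<Rightarrow> (agent \<Rightarrow> bool) \<Rightarrow> (agent \<Rightarrow> bool) \<Rightarrow> command" where
  "walk d turn go =
     \<lparr>duration = (if 0 < d then d else 1),
      action = (\<lambda>a. if turn a then Turn else Keep),
      progress = (\<lambda>a s. of_bool (go a) * s)\<rparr>"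

lemma valid_walk: "valid_command (walk d turn go)"
  by (auto simp: valid_command_def walk_def)

lemma contacts_subset_iff:
  "contacts x P \<subseteq> contacts x Q \<longleftrightarrow>
    (\<forall>a. (P a = 0 \<longrightarrow> Q a = 0) \<and> (P a = x \<longrightarrow> Q a = x) \<and> (P a = P (other a) \<longrightarrow> Q a = Q (other a)))"
proof -
  have "Q a = Q (other a) \<longleftrightarrow> Q b = Q (other b)" for a b :: agent and Q :: "agent \<Rightarrow> real"
    by (cases a; cases b) auto
  then show ?thesis
    unfolding contacts_def by blast
qed

lemma phase_length_eq:
  assumes "0 \<le> l" "l \<le> duration c"
    and "\<And>s. 0 \<le> s \<Longrightarrow> s < l \<Longrightarrow> contacts x (moved c pos dir s) \<subseteq> contacts x pos"
    and "l = duration c \<or> \<not> contacts x (moved c pos dir l) \<subseteq> contacts x pos"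
  shows "phase_length x c pos dir = l"
  unfolding phase_length_def
proof (rule cInf_eq_minimum)
  fix s assume "s \<in> insert (duration c)
       {s \<in> {0..duration c}. \<not> contacts x (moved c pos dir s) \<subseteq> contacts x pos}"
  then show "l \<le> s" using assms(1,2) assms(3)[of s] by (cases "s < l") auto
qed (use assms in auto)

text \<open>
  Coordinates are scaled by \<open>\<sigma>\<close>, which will be \<open>1\<close> or \<open>-1\<close>, so that both sides of the origin
  can be treated at once.
\<close>

lemma step_walk:
  fixes P H :: "agent \<Rightarrow> real"
  assumes S: "position S = (\<lambda>a. \<sigma> * P a)" "heading S = (\<lambda>a. \<sigma> * H a)"
    and \<sigma>: "\<sigma> \<noteq> 0" and x: "x = \<sigma> * \<xi>"
    and dec: "decide alg (past S) = walk d turn go"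
    and H': "\<And>a. H' a = (if turn a \<and> \<not> fault w a then - H a else H a)"
    and P': "\<And>a s. P' s a = P a + H' a * of_bool (go a) * s"
    and l: "0 \<le> l" "l \<le> d" "0 < d"
    and free: "\<And>s a. 0 \<le> s \<Longrightarrow> s < l \<Longrightarrow> (P' s a = 0 \<longrightarrow> P a = 0) \<and> (P' s a = \<xi> \<longrightarrow> P a = \<xi>) \<and>
      (P' s a = P' s (other a) \<longrightarrow> P a = P (other a))"
    and new: "l = d \<or> (\<exists>a. P' l a = 0 \<and> P a \<noteq> 0 \<or> P' l a = \<xi> \<and> P a \<noteq> \<xi> \<or>
      P' l a = P' l (other a) \<and> P a \<noteq> P (other a))"
  shows "step alg x w S = \<lparr>clock = clock S + l, position = (\<lambda>a. \<sigma> * P' l a), heading = (\<lambda>a. \<sigma> * H' a),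
    past = (clock S + l, contacts x (\<lambda>a. \<sigma> * P' l a)) # past S\<rparr>"
proof -
  have h: "new_heading (walk d turn go) w (position S) (heading S) = (\<lambda>a. \<sigma> * H' a)"
    by (rule ext) (simp add: new_heading_def walk_def S H')
  have m: "moved (walk d turn go) (position S) (\<lambda>a. \<sigma> * H' a) s = (\<lambda>a. \<sigma> * P' s a)" for s
    by (rule ext) (simp add: moved_def walk_def S P' algebra_simps)
  have "phase_length x (walk d turn go) (position S) (\<lambda>a. \<sigma> * H' a) = l"
  proof (rule phase_length_eq)
    show "contacts x (moved (walk d turn go) (position S) (\<lambda>a. \<sigma> * H' a) s) \<subseteq> contacts x (position S)"
      if "0 \<le> s" "s < l" for s
      using free[OF that] unfolding m unfolding S contacts_subset_iff x using \<sigma> by simp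
    show "l = duration (walk d turn go) \<or>
        \<not> contacts x (moved (walk d turn go) (position S) (\<lambda>a. \<sigma> * H' a) l) \<subseteq> contacts x (position S)"
      using new l unfolding m unfolding S contacts_subset_iff x using \<sigma> by (auto simp: walk_def)
  qed (use l in \<open>auto simp: walk_def\<close>)
  then show ?thesis by (simp add: step_def Let_def dec h m)
qed

lemma contacts_simps [simp]:
  "AtOrigin a \<in> contacts x P \<longleftrightarrow> P a = 0"
  "AtTarget a \<in> contacts x P \<longleftrightarrow> P a = x"
  "Together \<in> contacts x P \<longleftrightarrow> P Agent1 = P Agent2"
proof -
  have "(\<exists>a. P a = P (other a)) \<longleftrightarrow> P Agent1 = P Agent2"
    by (metis agent.exhaust other.simps)
  then show "Together \<in> contacts x P \<longleftrightarrow> P Agent1 = P Agent2"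
    by (auto simp: contacts_def)
qed (auto simp: contacts_def)

lemma other_neq [simp]: "other a \<noteq> a" "a \<noteq> other a"
  by (cases a; simp)+

lemma other_other [simp]: "other (other a) = a"
  by (cases a) auto

lemma eq_other_iff: "a \<noteq> b \<longleftrightarrow> a = other b"
  by (cases a; cases b) auto

section \<open>Searching in opposite directions\<close>

text \<open>
  After the discovery the other agent is at distance \<open>t\<close> from the origin at time \<open>t\<close> as long as all
  its attempts to turn fail. It learns the outcome of an attempt after a walk of this length, from
  whether it has reached the origin.
\<close>

definition diverge :: algorithm where
  "diverge =
     \<lparr>start = (\<lambda>a. case a of Agent1 \<Rightarrow> -1 | Agent2 \<Rightarrow> 1),
      decide = (\<lambda>h. let (t, C) = hd h in
        if \<forall>a. AtTarget a \<notin> C then walk 1 (\<lambda>_. False) (\<lambda>_. True)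
        else walk t (\<lambda>a. AtTarget a \<notin> C \<and> AtOrigin a \<notin> C) (\<lambda>a. AtTarget a \<notin> C))\<rparr>"

lemma valid_diverge: "valid_algorithm diverge"
  by (auto simp: valid_algorithm_def diverge_def valid_walk split: prod.split agent.split)

definition split_pos :: "agent \<Rightarrow> real \<Rightarrow> real \<Rightarrow> agent \<Rightarrow> real" where
  "split_pos F u v = (\<lambda>a. if a = F then u else v)"

lemma split_pos_simps [simp]:
  "split_pos F u v F = u" "split_pos F u v (other F) = v"
  by (auto simp: split_pos_def)

text \<open>Agent \<open>F\<close> is the one that finds the target, which is at \<open>\<sigma> * \<xi>\<close> with \<open>\<xi> > 0\<close>.\<close>

inductive diverge_bound :: "real \<Rightarrow> real \<Rightarrow> agent \<Rightarrow> real \<Rightarrow> real \<Rightarrow> config \<Rightarrow> real \<Rightarrow> bool"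
  for c p F \<sigma> \<xi> where
  explore: "diverge_bound c p F \<sigma> \<xi> S ((1 + c) * (\<xi> - t) + c + (\<xi> / (1 - 2 * p) + \<xi> + 3 * c))"
    if "hd (past S) = (clock S, contacts (\<sigma> * \<xi>) (position S))" "clock S = t" "0 \<le> t" "t < \<xi>"
      "position S = (\<lambda>a. \<sigma> * split_pos F t (- t) a)" "heading S = (\<lambda>a. \<sigma> * split_pos F 1 (- 1) a)"
| retreat: "diverge_bound c p F \<sigma> \<xi> S (d / (1 - 2 * p) + \<xi> + 3 * c)"
    if "hd (past S) = (clock S, contacts (\<sigma> * \<xi>) (position S))" "clock S = d" "\<xi> \<le> d"
      "position S = (\<lambda>a. \<sigma> * split_pos F \<xi> (- d) a)" "heading S = (\<lambda>a. \<sigma> * split_pos F 1 (- 1) a)"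
| home: "diverge_bound c p F \<sigma> \<xi> S (\<xi> + c)"
    if "hd (past S) = (clock S, contacts (\<sigma> * \<xi>) (position S))" "\<xi> \<le> clock S"
      "position S = (\<lambda>a. \<sigma> * split_pos F \<xi> 0 a)" "heading S = (\<lambda>a. \<sigma> * split_pos F 1 1 a)"

lemma step_diverge_explore:
  assumes "hd (past S) = (clock S, contacts (\<sigma> * \<xi>) (position S))" "0 \<le> t" "t < \<xi>" "\<sigma> \<noteq> 0"
    "position S = (\<lambda>a. \<sigma> * split_pos F t (- t) a)" "heading S = (\<lambda>a. \<sigma> * split_pos F 1 (- 1) a)"
  defines "l \<equiv> min 1 (\<xi> - t)"
  defines "Q \<equiv> (\<lambda>a. \<sigma> * split_pos F (t + l) (- (t + l)) a)"
  shows "step diverge (\<sigma> * \<xi>) w S =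
    \<lparr>clock = clock S + l, position = Q, heading = heading S,
     past = (clock S + l, contacts (\<sigma> * \<xi>) Q) # past S\<rparr>"
  unfolding Q_def
proof (subst step_walk[where \<sigma> = \<sigma> and P = "split_pos F t (- t)" and H = "split_pos F 1 (- 1)" and \<xi> = \<xi> and l = l and d = 1
      and turn = "\<lambda>_. False" and go = "\<lambda>_. True" and H' = "split_pos F 1 (- 1)"
      and P' = "\<lambda>s. split_pos F (t + s) (- (t + s))"])
  show "decide diverge (past S) = walk 1 (\<lambda>_. False) (\<lambda>_. True)"
    using assms(1-6) by (auto simp: diverge_def split_pos_def)
  show "l = 1 \<or> (\<exists>a. split_pos F (t + l) (- (t + l)) a = 0 \<and> split_pos F t (- t) a \<noteq> 0 \<or>
         split_pos F (t + l) (- (t + l)) a = \<xi> \<and> split_pos F t (- t) a \<noteq> \<xi> \<or>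
         split_pos F (t + l) (- (t + l)) a = split_pos F (t + l) (- (t + l)) (other a) \<and>
         split_pos F t (- t) a \<noteq> split_pos F t (- t) (other a))"
    using assms(1-6) by (auto simp: l_def min_def intro!: exI[of _ F])
qed (use assms(1-6) in \<open>auto simp: split_pos_def l_def eq_other_iff split: if_splits\<close>)

lemma step_diverge_retreat:
  fixes w :: "bool \<times> bool"
  assumes "hd (past S) = (clock S, contacts (\<sigma> * \<xi>) (position S))" "clock S = d" "0 < \<xi>" "\<xi> \<le> d" "\<sigma> \<noteq> 0"
    "position S = (\<lambda>a. \<sigma> * split_pos F \<xi> (- d) a)" "heading S = (\<lambda>a. \<sigma> * split_pos F 1 (- 1) a)"
  defines "h \<equiv> (if fault w (other F) then - 1 else 1)"
  defines "Q \<equiv> (\<lambda>a. \<sigma> * split_pos F \<xi> (- d + h * d) a)"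
  shows "step diverge (\<sigma> * \<xi>) w S =
    \<lparr>clock = 2 * d, position = Q, heading = (\<lambda>a. \<sigma> * split_pos F 1 h a),
     past = (2 * d, contacts (\<sigma> * \<xi>) Q) # past S\<rparr>"
  unfolding Q_def
proof (subst step_walk[where \<sigma> = \<sigma> and P = "split_pos F \<xi> (- d)" and H = "split_pos F 1 (- 1)" and \<xi> = \<xi> and l = d and d = d
      and turn = "\<lambda>a. a \<noteq> F" and go = "\<lambda>a. a \<noteq> F" and H' = "split_pos F 1 h"
      and P' = "\<lambda>s. split_pos F \<xi> (- d + h * s)"])
  show "decide diverge (past S) = walk d (\<lambda>a. a \<noteq> F) (\<lambda>a. a \<noteq> F)"
    using assms(1-7) by (auto simp: diverge_def split_pos_def intro!: arg_cong2[of _ _ _ _ "walk d"])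
qed (use assms(1-7) in \<open>auto simp: split_pos_def h_def eq_other_iff split: if_splits\<close>)

lemma step_diverge_home:
  assumes "hd (past S) = (clock S, contacts (\<sigma> * \<xi>) (position S))" "0 < \<xi>" "\<xi> \<le> clock S" "\<sigma> \<noteq> 0"
    "position S = (\<lambda>a. \<sigma> * split_pos F \<xi> 0 a)" "heading S = (\<lambda>a. \<sigma> * split_pos F 1 1 a)"
  defines "Q \<equiv> (\<lambda>a. \<sigma> * split_pos F \<xi> \<xi> a)"
  shows "step diverge (\<sigma> * \<xi>) w S =
    \<lparr>clock = clock S + \<xi>, position = Q, heading = heading S,
     past = (clock S + \<xi>, contacts (\<sigma> * \<xi>) Q) # past S\<rparr>"
  unfolding Q_def
proof (subst step_walk[where \<sigma> = \<sigma> and P = "split_pos F \<xi> 0" and H = "split_pos F 1 1" and \<xi> = \<xi> and l = \<xi>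
      and d = "clock S" and turn = "\<lambda>_. False" and go = "\<lambda>a. a \<noteq> F" and H' = "split_pos F 1 1"
      and P' = "\<lambda>s. split_pos F \<xi> s"])
  show "decide diverge (past S) = walk (clock S) (\<lambda>_. False) (\<lambda>a. a \<noteq> F)"
    using assms(1-6) by (auto simp: diverge_def split_pos_def intro!: arg_cong2[of _ _ _ _ "walk _"])
  show "\<xi> = clock S \<or> (\<exists>a. split_pos F \<xi> \<xi> a = 0 \<and> split_pos F \<xi> 0 a \<noteq> 0 \<or>
         split_pos F \<xi> \<xi> a = \<xi> \<and> split_pos F \<xi> 0 a \<noteq> \<xi> \<or>
         split_pos F \<xi> \<xi> a = split_pos F \<xi> \<xi> (other a) \<and>
         split_pos F \<xi> 0 a \<noteq> split_pos F \<xi> 0 (other a))"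
    using assms(1-6) by (auto intro!: exI[of _ "other F"])
qed (use assms(1-6) in \<open>auto simp: split_pos_def eq_other_iff split: if_splits\<close>)

lemma diverge_bound_step:
  assumes p: "0 \<le> p" "p < 1 / 2" and c: "0 < c" and \<xi>: "0 < \<xi>" and \<sigma>: "\<sigma> \<noteq> 0"
    and S: "diverge_bound c p F \<sigma> \<xi> S v"
  shows "potential_step p c diverge (\<sigma> * \<xi>) (diverge_bound c p F \<sigma> \<xi>) S v"
  using S
proof cases
  case (explore t)
  note step = step_diverge_explore[OF explore(2,4,5) \<sigma> explore(6,7)]
  let ?R = "\<xi> / (1 - 2 * p) + \<xi> + 3 * c"
  have R: "0 \<le> ?R" using p c \<xi> by (auto intro!: add_nonneg_nonneg)
  show ?thesis
  proof (cases "\<xi> - t \<le> 1")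
    case True
    have "diverge_bound c p F \<sigma> \<xi> (step diverge (\<sigma> * \<xi>) w S) ?R" for w
      unfolding step using True explore by (intro diverge_bound.retreat) (auto simp: min_def)
    moreover have "clock (step diverge (\<sigma> * \<xi>) w S) - clock S \<le> \<xi> - t" for w
      unfolding step by simp
    moreover have "(\<xi> - t) + c + ?R \<le> v"
      unfolding explore using c explore by (simp add: algebra_simps)
    ultimately show ?thesis
      using R by (intro potential_step_constI[where l = "\<xi> - t" and v' = ?R]) simp_all
  next
    case False
    let ?v = "(1 + c) * (\<xi> - (t + 1)) + c + ?R"
    have "diverge_bound c p F \<sigma> \<xi> (step diverge (\<sigma> * \<xi>) w S) ?v" for w
      unfolding step using False explore by (intro diverge_bound.explore) (auto simp: min_def)
    moreover have "clock (step diverge (\<sigma> * \<xi>) w S) - clock S \<le> 1" for w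
      unfolding step by simp
    moreover have "0 \<le> ?v" using c False by (intro add_nonneg_nonneg[OF add_nonneg_nonneg R]) auto
    ultimately show ?thesis
      unfolding explore(1)
      by (intro potential_step_constI[where l = 1 and v' = ?v]) (simp_all add: algebra_simps)
  qed
next
  case (retreat d)
  note step = step_diverge_retreat[OF retreat(2,3) \<xi> retreat(4) \<sigma> retreat(5,6)]
  let ?v = "\<lambda>b. if b then 2 * d / (1 - 2 * p) + \<xi> + 3 * c else \<xi> + c"
  have "diverge_bound c p F \<sigma> \<xi> (step diverge (\<sigma> * \<xi>) w S) (?v (fault w (other F)))" for w
    unfolding step using retreat \<xi>
    by (auto intro!: diverge_bound.retreat diverge_bound.home)
  moreover have "clock (step diverge (\<sigma> * \<xi>) w S) - clock S \<le> d" for w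
    unfolding step using retreat by simp
  moreover have "0 \<le> ?v b" for b using p c \<xi> retreat by (auto intro!: add_nonneg_nonneg)
  \<comment> \<open>The expected surcharge is \<open>p * 4 * c + (1 - p) * 2 * c\<close>, which is
    \<open>2 * c + 2 * p * c\<close> and thus at most \<open>3 * c\<close> by
    \<open>p < 1 / 2\<close>.\<close>
  moreover have "p * (d + c + ?v True) + (1 - p) * (d + c + ?v False) \<le> v"
  proof -
    have "d / (1 - 2 * p) = d + 2 * p * (d / (1 - 2 * p))" using p by (simp add: field_simps)
    moreover have "c * p \<le> c * (1 / 2)" using p c by (intro mult_left_mono) auto
    ultimately show ?thesis unfolding retreat(1) by (simp add: algebra_simps)
  qed
  ultimately show ?thesis
    by (intro potential_stepI[where a = "other F" and l = "\<lambda>_. d" and v' = ?v]) blast+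
next
  case home
  note step = step_diverge_home[OF home(2) \<xi> home(3) \<sigma> home(4,5)]
  have "found (\<sigma> * \<xi>) (step diverge (\<sigma> * \<xi>) w S)" for w
    unfolding step found_def by (simp add: split_pos_def)
  moreover have "clock (step diverge (\<sigma> * \<xi>) w S) - clock S \<le> \<xi>" for w
    unfolding step by simp
  ultimately show ?thesis
    unfolding home by (intro potential_step_constI[where l = \<xi> and v' = 0]) simp_all
qed

lemma expected_search_time_diverge:
  assumes p: "0 \<le> p" "p < 1 / 2" and c: "0 < c"
  shows "expected_search_time p diverge x \<le> ennreal ((2 + 1 / (1 - 2 * p) + c) * \<bar>x\<bar> + 4 * c)"
proof (cases "x = 0")
  case True
  show ?thesis
    using True p c
    by (intro expected_search_time_le[where G = "\<lambda>_ _. False" and c = c] valid_diverge)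
      (auto simp: found_def initial_def)
next
  case False
  define \<sigma> where "\<sigma> = sgn x"
  define F where "F = (if 0 < x then Agent2 else Agent1)"
  have \<sigma>: "\<sigma> \<noteq> 0" "x = \<sigma> * \<bar>x\<bar>" using False by (auto simp: \<sigma>_def sgn_if)
  have v: "(2 + 1 / (1 - 2 * p) + c) * \<bar>x\<bar> + 4 * c =
      (1 + c) * (\<bar>x\<bar> - 0) + c + (\<bar>x\<bar> / (1 - 2 * p) + \<bar>x\<bar> + 3 * c)"
    by (simp add: algebra_simps)
  have "diverge_bound c p F \<sigma> \<bar>x\<bar> (initial diverge x) ((2 + 1 / (1 - 2 * p) + c) * \<bar>x\<bar> + 4 * c)"
    unfolding v using False \<sigma>
    by (intro diverge_bound.explore)
      (auto simp: initial_def diverge_def F_def \<sigma>_def split_pos_def sgn_if fun_eq_iff split: agent.split)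
  then show ?thesis
    using p c False \<sigma> diverge_bound_step[OF p c _ \<sigma>(1), of "\<bar>x\<bar>" F, folded \<sigma>(2)]
    by (intro expected_search_time_le[where G = "diverge_bound c p F \<sigma> \<bar>x\<bar>" and c = c] valid_diverge)
      auto
qed

lemma diverge_search:
  assumes p: "0 \<le> p" "p < 1 / 2" and \<epsilon>: "0 < \<epsilon>"
  shows "solves_search p diverge" "competitive_ratio p diverge \<le> ennreal (2 + 1 / (1 - 2 * p) + \<epsilon>)"
proof -
  show "solves_search p diverge"
    using expected_search_time_diverge[OF p zero_less_one]
    by (intro solves_searchI) (metis ennreal_less_top infinity_ennreal_def le_less_trans)
  show "competitive_ratio p diverge \<le> ennreal (2 + 1 / (1 - 2 * p) + \<epsilon>)"
  proof (rule competitive_ratio_leI[where b = 1])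
    fix x :: real assume "1 \<le> \<bar>x\<bar>"
    then have "\<epsilon> * 1 \<le> \<epsilon> * \<bar>x\<bar>" using \<epsilon> by (intro mult_left_mono) auto
    then have "\<epsilon> / 5 * \<bar>x\<bar> + 4 * (\<epsilon> / 5) \<le> \<epsilon> * \<bar>x\<bar>" by linarith
    then have "(2 + 1 / (1 - 2 * p) + \<epsilon> / 5) * \<bar>x\<bar> + 4 * (\<epsilon> / 5) \<le> (2 + 1 / (1 - 2 * p) + \<epsilon>) * \<bar>x\<bar>"
      unfolding distrib_right by linarith
    then show "expected_search_time p diverge x \<le> ennreal ((2 + 1 / (1 - 2 * p) + \<epsilon>) * \<bar>x\<bar>)"
      using \<epsilon> expected_search_time_diverge[OF p, of "\<epsilon> / 5" x] by (meson ennreal_leI order_trans zero_less_divide_iff zero_less_numeral)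
  qed
qed

section \<open>A pair that turns reliably\<close>

text \<open>
  The agents walk together, alternately to the right (\<open>n\<close> even) and to the left (\<open>n\<close> odd) of the
  origin. On level \<open>n\<close> they walk to distance \<open>radius n j\<close> (\<open>Out\<close>). Then \<open>Agent1\<close> attempts to turn
  while \<open>Agent2\<close> keeps walking: staying together reveals a failure (\<open>Attempt y\<close>, at distance \<open>y\<close>).
  After a success \<open>Agent1\<close> waits at distance \<open>z\<close> for \<open>Agent2\<close>, which is at distance \<open>d\<close> from it
  and attempts to turn; if it has not arrived after time \<open>d\<close>, it is at distance \<open>2 * d\<close>.
  In \<open>Regroup z d r\<close> a time \<open>r\<close> of this attempt remains; \<open>r < d\<close> only occurs
  if \<open>Agent2\<close> has come across the target. Finally both agents return to the origin (\<open>Back z\<close>).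

  The number \<open>j\<close> of failures of \<open>Agent1\<close> on the first \<open>N\<close> levels serves as a source of randomness:
  modulo 32 it is almost uniformly distributed.
\<close>

datatype mode = Out | Attempt real | Regroup real real real | Back real

locale zigzag =
  fixes N :: nat and \<eta> :: real
  assumes \<eta>: "0 < \<eta>" "\<eta> < 1"
begin

text \<open>Radius 1 keeps the random-bit levels cheap. From level \<open>N\<close> on, sides
  alternate while the exponent grows by 16, so on each side the exponents form one residue class
  modulo 32, fixed by \<open>j\<close>.\<close>

definition radius :: "nat \<Rightarrow> nat \<Rightarrow> real" where
  "radius n j = (if n < N then 1 else (27 / 25) ^ (j mod 32 + 16 * (n - N)))"

text \<open>Counting stops at level \<open>N\<close>, so later failures do not alter the turning
  points.\<close>

definition bump :: "nat \<Rightarrow> nat \<Rightarrow> nat" where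
  "bump n j = (if n < N then Suc j else j)"

definition dir :: "nat \<Rightarrow> real" where
  "dir n = (- 1) ^ n"

fun command_of :: "nat \<times> nat \<times> mode \<Rightarrow> command" where
  "command_of (n, j, Out) = walk (radius n j) (\<lambda>_. False) (\<lambda>_. True)"
| "command_of (n, j, Attempt y) = walk (\<eta> * radius n j) (\<lambda>a. a = Agent1) (\<lambda>_. True)"
| "command_of (n, j, Regroup z d r) = walk r (\<lambda>a. a = Agent2 \<and> r = d) (\<lambda>a. a = Agent2)"
| "command_of (n, j, Back z) = walk z (\<lambda>_. False) (\<lambda>_. True)"

text \<open>\<open>Out\<close> and \<open>Back\<close> ignore \<open>l\<close>: only the target can
  cut a joint walk short, and then the search is over. In \<open>Regroup\<close>,
  \<open>l < r\<close> without a meeting means that \<open>Agent2\<close> was interrupted at the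
  target; the rest of the walk follows without a new attempt to turn.\<close>

fun advance :: "real \<Rightarrow> contact set \<Rightarrow> nat \<times> nat \<times> mode \<Rightarrow> nat \<times> nat \<times> mode" where
  "advance l C (n, j, Out) = (n, j, Attempt (radius n j))"
| "advance l C (n, j, Attempt y) =
     (if Together \<in> C then (n, bump n j, Attempt (y + l)) else (n, j, Regroup (y - l) (2 * l) (2 * l)))"
| "advance l C (n, j, Regroup z d r) =
     (if Together \<in> C then (n, j, Back z)
      else if l < r then (n, j, Regroup z d (r - l)) else (n, j, Regroup z (2 * d) (2 * d)))"
| "advance l C (n, j, Back z) = (Suc n, j, Out)"

text \<open>Agents have no memory besides the history, so the state of the plan is recomputed from
  the phase lengths and the contacts at their ends.\<close>

fun plan_of :: "history \<Rightarrow> nat \<times> nat \<times> mode" where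
  "plan_of ((t, C) # (t', C') # h) = advance (t - t') C (plan_of ((t', C') # h))"
| "plan_of _ = (0, 0, Out)"

definition alg :: algorithm where
  "alg = \<lparr>start = (\<lambda>_. 1), decide = (\<lambda>h. command_of (plan_of h))\<rparr>"

lemma valid_alg: "valid_algorithm alg"
proof -
  have "valid_command (command_of \<pi>)" for \<pi>
    by (cases \<pi> rule: command_of.cases) (simp_all add: valid_walk)
  then show ?thesis by (simp add: valid_algorithm_def alg_def)
qed

lemma radius_ge_1: "1 \<le> radius n j"
  by (simp add: radius_def)

lemma radius_bump [simp]: "radius n (bump n j) = radius n j"
  by (simp add: radius_def bump_def)

lemma dir_Suc [simp]: "dir (Suc n) = - dir n"
  by (simp add: dir_def)

lemma dir_square [simp]: "dir n * (dir n * x) = x"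
  by (simp add: dir_def flip: mult.assoc power_mult_distrib)

lemma dir_neq_0 [simp]: "dir n \<noteq> 0"
  by (simp add: dir_def)

definition tracks :: "config \<Rightarrow> nat \<times> nat \<times> mode \<Rightarrow> bool" where
  "tracks S \<pi> \<longleftrightarrow> past S \<noteq> [] \<and> fst (hd (past S)) = clock S \<and> plan_of (past S) = \<pi>"

lemma split_pos_Agent2 [simp]: "split_pos Agent1 u v Agent2 = v"
  by (simp add: split_pos_def)

text \<open>Reduces each mode to choosing \<open>l\<close> and checking linear conditions.
  Multiplying by \<open>dir n\<close> puts the excursion of level \<open>n\<close> on the positive
  side. A meeting is absent from the last premise because in this plan it occurs exactly when the
  commanded duration ends.\<close>

lemma step_zigzag:
  assumes "tracks S (n, j, m)" "command_of (n, j, m) = walk d turn go"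
    and "position S = (\<lambda>a. dir n * split_pos Agent1 u v a)"
    and "heading S = (\<lambda>a. dir n * split_pos Agent1 h k a)"
    and h': "h' = (if turn Agent1 \<and> \<not> fault w Agent1 then - h else h)"
    and k': "k' = (if turn Agent2 \<and> \<not> fault w Agent2 then - k else k)"
    and fg: "f = of_bool (go Agent1) * h'" "g = of_bool (go Agent2) * k'"
    and "0 \<le> l" "l \<le> d" "0 < d"
    and free: "\<And>s. 0 \<le> s \<Longrightarrow> s < l \<Longrightarrow> (u + f * s = 0 \<longrightarrow> u = 0) \<and> (v + g * s = 0 \<longrightarrow> v = 0) \<and>
      (u + f * s = dir n * x \<longrightarrow> u = dir n * x) \<and> (v + g * s = dir n * x \<longrightarrow> v = dir n * x) \<and>
      (u + f * s = v + g * s \<longrightarrow> u = v)"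
    and new: "l = d \<or> u + f * l = 0 \<and> u \<noteq> 0 \<or> v + g * l = 0 \<and> v \<noteq> 0 \<or>
      u + f * l = dir n * x \<and> u \<noteq> dir n * x \<or> v + g * l = dir n * x \<and> v \<noteq> dir n * x"
  shows "clock (step alg x w S) = clock S + l \<and>
    position (step alg x w S) = (\<lambda>a. dir n * split_pos Agent1 (u + f * l) (v + g * l) a) \<and>
    heading (step alg x w S) = (\<lambda>a. dir n * split_pos Agent1 h' k' a) \<and>
    tracks (step alg x w S)
      (advance l (contacts x (\<lambda>a. dir n * split_pos Agent1 (u + f * l) (v + g * l) a)) (n, j, m))"
proof -
  have *: "step alg x w S = \<lparr>clock = clock S + l,
      position = (\<lambda>a. dir n * split_pos Agent1 (u + f * l) (v + g * l) a),
      heading = (\<lambda>a. dir n * split_pos Agent1 h' k' a),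
      past = (clock S + l, contacts x (\<lambda>a. dir n * split_pos Agent1 (u + f * l) (v + g * l) a)) # past S\<rparr>"
  proof (rule step_walk[where P = "split_pos Agent1 u v" and H = "split_pos Agent1 h k" and \<xi> = "dir n * x"
        and d = d and turn = turn and go = go and P' = "\<lambda>s. split_pos Agent1 (u + f * s) (v + g * s)"])
    show "decide alg (past S) = walk d turn go"
      using assms(1,2) by (simp add: alg_def tracks_def)
    show "split_pos Agent1 h' k' a = (if turn a \<and> \<not> fault w a then - split_pos Agent1 h k a else split_pos Agent1 h k a)" for a
      using h' k' by (cases a) (auto simp: split_pos_def)
    show "split_pos Agent1 (u + f * s) (v + g * s) a =
        split_pos Agent1 u v a + split_pos Agent1 h' k' a * of_bool (go a) * s" for a s
      using fg by (cases a) (auto simp: split_pos_def)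
    show "(split_pos Agent1 (u + f * s) (v + g * s) a = 0 \<longrightarrow> split_pos Agent1 u v a = 0) \<and>
        (split_pos Agent1 (u + f * s) (v + g * s) a = dir n * x \<longrightarrow> split_pos Agent1 u v a = dir n * x) \<and>
        (split_pos Agent1 (u + f * s) (v + g * s) a = split_pos Agent1 (u + f * s) (v + g * s) (other a) \<longrightarrow>
         split_pos Agent1 u v a = split_pos Agent1 u v (other a))" if "0 \<le> s" "s < l" for s a
      using free[OF that] by (cases a) (auto simp: split_pos_def)
    have 1: "split_pos Agent1 p q Agent1 = p" "split_pos Agent1 p q Agent2 = q" for p q
      by (simp_all add: split_pos_def)
    have ex: "(\<exists>a. P a) \<longleftrightarrow> P Agent1 \<or> P Agent2" for P by (metis agent.exhaust)
    show "l = d \<or> (\<exists>a. split_pos Agent1 (u + f * l) (v + g * l) a = 0 \<and> split_pos Agent1 u v a \<noteq> 0 \<or>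
        split_pos Agent1 (u + f * l) (v + g * l) a = dir n * x \<and> split_pos Agent1 u v a \<noteq> dir n * x \<or>
        split_pos Agent1 (u + f * l) (v + g * l) a = split_pos Agent1 (u + f * l) (v + g * l) (other a) \<and>
        split_pos Agent1 u v a \<noteq> split_pos Agent1 u v (other a))"
      using new unfolding ex 1 by blast
  qed (use assms in simp_all)
  show ?thesis
    using assms(1) unfolding * tracks_def by (cases "past S") auto
qed

lemma found_iff:
  "position S = (\<lambda>a. dir n * split_pos Agent1 u v a) \<Longrightarrow> found x S \<longleftrightarrow> u = dir n * x \<and> v = dir n * x"
  unfolding found_def split_pos_def
  by (smt (verit) agent.exhaust agent.distinct(1) dir_square)

end

text \<open>
  \<open>Q n j\<close> bounds the expected remaining cost at the start of level \<open>n\<close> and \<open>D n j\<close> the part of it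
  that comes after level \<open>n\<close>; for given \<open>j\<close> the target is reached on level \<open>H j\<close> at the latest.
\<close>

locale zigzag_potential = zigzag +
  fixes p x :: real and Q D :: "nat \<Rightarrow> nat \<Rightarrow> real" and H :: "nat \<Rightarrow> nat" and B :: real
  assumes p: "0 \<le> p" "p < 1 / 2"
    and B: "B = 1 / (1 - 2 * p)"
    and Q_nonneg: "0 \<le> Q n j"
    and D_nonneg: "0 \<le> D n j"
    and D: "p * D n (bump n j) + (1 - p) * Q (Suc n) j \<le> D n j"
    and Q_step: "n < N \<or> n < H j \<Longrightarrow> (2 + (11 + 2 * B) * \<eta>) * radius n j + D n j \<le> Q n j"
    and Q_hit: "\<bar>x\<bar> + \<eta> \<le> Q (H j) j"
    and N_le_H: "N \<le> H j"
    and hit: "0 \<le> dir (H j) * x" "\<bar>x\<bar> \<le> radius (H j) j"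
begin

text \<open>\<open>B\<close> is the expected regrouping time per unit of distance: walk that
  distance once, and with probability \<open>p\<close> start again from twice the distance.\<close>

lemma B_ge_0: "0 \<le> B" and B_eq: "B = 1 + 2 * p * B"
  using p by (auto simp: B field_simps)

text \<open>The multiples of \<eta> count surcharges. Regrouping takes fewer than two tries on
  average, of at most two phases each: 4. Less than one failed attempt is expected: 1. With the
  successful attempt and the walk back this makes 7. In the radius term, \<open>2 * B\<close> pays
  for regrouping from distance at most \<open>2 * \<eta> * radius n j\<close>, and 3 for the ground
  lost by failures. \<open>approach\<close> and \<open>recede\<close> describe \<open>Agent2\<close>
  stopped at the target on its way.\<close>

inductive bound :: "config \<Rightarrow> real \<Rightarrow> bool" where
  out: "bound S (Q n j)"
    if "tracks S (n, j, Out)" "n < N \<or> n \<le> H j"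
      "position S = (\<lambda>a. dir n * split_pos Agent1 0 0 a)"
      "heading S = (\<lambda>a. dir n * split_pos Agent1 1 1 a)"
| attempt: "bound S (y + (3 + 2 * B) * \<eta> * radius n j + 7 * \<eta> + D n j)"
    if "tracks S (n, j, Attempt y)" "n < N \<or> n < H j"
      "position S = (\<lambda>a. dir n * split_pos Agent1 y y a)"
      "heading S = (\<lambda>a. dir n * split_pos Agent1 1 1 a)"
      "radius n j \<le> y" "\<not> (0 \<le> dir n * x \<and> dir n * x \<le> y)"
| regroup: "bound S (B * d + 4 * \<eta> + (z + \<eta> + Q (Suc n) j))"
    if "tracks S (n, j, Regroup z d d)" "n < N \<or> n < H j"
      "position S = (\<lambda>a. dir n * split_pos Agent1 z (z + d) a)"
      "heading S = (\<lambda>a. dir n * split_pos Agent1 (- 1) 1 a)"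
      "0 < z" "0 < d" "\<not> (0 \<le> dir n * x \<and> dir n * x \<le> z)"
| approach: "bound S (r + \<eta> + (z + \<eta> + Q (Suc n) j))"
    if "tracks S (n, j, Regroup z d r)" "n < N \<or> n < H j"
      "position S = (\<lambda>a. dir n * split_pos Agent1 z (z + r) a)"
      "heading S = (\<lambda>a. dir n * split_pos Agent1 (- 1) (- 1) a)"
      "0 < z" "0 < r" "r < d" "dir n * x = z + r"
| recede: "bound S (r + \<eta> + (B * (2 * d) + 4 * \<eta> + (z + \<eta> + Q (Suc n) j)))"
    if "tracks S (n, j, Regroup z d r)" "n < N \<or> n < H j"
      "position S = (\<lambda>a. dir n * split_pos Agent1 z (z + 2 * d - r) a)"
      "heading S = (\<lambda>a. dir n * split_pos Agent1 (- 1) 1 a)"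
      "0 < z" "0 < r" "r < d" "dir n * x = z + 2 * d - r"
| return: "bound S (z + \<eta> + Q (Suc n) j)"
    if "tracks S (n, j, Back z)" "n < N \<or> n < H j"
      "position S = (\<lambda>a. dir n * split_pos Agent1 z z a)"
      "heading S = (\<lambda>a. dir n * split_pos Agent1 (- 1) (- 1) a)"
      "0 < z" "\<not> (0 \<le> dir n * x \<and> dir n * x \<le> z)"

lemma bound_nonneg: "bound S v \<Longrightarrow> 0 \<le> v"
proof (induction rule: bound.induct)
  case (attempt S n j y)
  then show ?case
    using \<eta> B_ge_0 D_nonneg radius_ge_1[of n j] by (intro add_nonneg_nonneg mult_nonneg_nonneg) auto
qed (use \<eta> B_ge_0 Q_nonneg in \<open>auto intro!: add_nonneg_nonneg\<close>)

abbreviation "progresses \<equiv> potential_step p \<eta> alg x bound"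

section \<open>One-phase estimates for the potential, mode by mode\<close>

lemma out_step:
  assumes "tracks S (n, j, Out)" "n < N \<or> n \<le> H j"
    and pos: "position S = (\<lambda>a. dir n * split_pos Agent1 0 0 a)"
    and "heading S = (\<lambda>a. dir n * split_pos Agent1 1 1 a)"
    and nf: "\<not> found x S"
  shows "progresses S (Q n j)"
proof -
  let ?R = "radius n j"
  have R: "1 \<le> ?R" by (rule radius_ge_1)
  have x0: "dir n * x \<noteq> 0" using nf unfolding found_iff[OF pos] by auto
  define l where "l = (if 0 < dir n * x \<and> dir n * x \<le> ?R then dir n * x else ?R)"
  have l: "0 \<le> l" "l \<le> ?R" using R by (auto simp: l_def)
  have *: "clock (step alg x w S) = clock S + l \<and>
    position (step alg x w S) = (\<lambda>a. dir n * split_pos Agent1 (0 + 1 * l) (0 + 1 * l) a) \<and>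
    heading (step alg x w S) = (\<lambda>a. dir n * split_pos Agent1 (1) (1) a) \<and>
    tracks (step alg x w S) (advance (l) (contacts x (\<lambda>a. dir n * split_pos Agent1 (0 + 1 * l) (0 + 1 * l) a)) (n, j, Out))" for w
    by (rule step_zigzag[OF assms(1) command_of.simps(1) assms(3,4)]) (use x0 R in \<open>auto simp: l_def split: if_splits\<close>)
  have step: "clock (step alg x w S) = clock S + l"
    "position (step alg x w S) = (\<lambda>a. dir n * split_pos Agent1 (0 + 1 * l) (0 + 1 * l) a)"
    "heading (step alg x w S) = (\<lambda>a. dir n * split_pos Agent1 (1) (1) a)"
    "tracks (step alg x w S) (n, j, Attempt ?R)" for w
    using *[of w] by auto
  show ?thesis
  proof (cases "0 < dir n * x \<and> dir n * x \<le> ?R")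
    case True
    \<comment> \<open>The pair may find the target before level \<open>H j\<close>; then the budget
      of the current level already covers the walk.\<close>
    have "l + \<eta> + 0 \<le> Q n j"
    proof (cases "n < N \<or> n < H j")
      case T: True
      have "(2 + (11 + 2 * B) * \<eta>) * ?R = 2 * ?R + 11 * (\<eta> * ?R) + 2 * (B * (\<eta> * ?R))"
        by (simp add: algebra_simps)
      moreover have "\<eta> * 1 \<le> \<eta> * ?R" using R \<eta> by (intro mult_left_mono) auto
      moreover have "0 \<le> B * (\<eta> * ?R)" using R \<eta> B_ge_0 by auto
      ultimately show ?thesis using Q_step[OF T] l R D_nonneg[of n j] \<eta> by linarith
    next
      case False
      then have "n = H j" using assms(2) by auto
      moreover have "l = \<bar>x\<bar>" using True by (auto simp: l_def dir_def abs_if minus_one_power_iff split: if_splits)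
      ultimately show ?thesis using Q_hit[of j] by simp
    qed
    then show ?thesis
      using True by (intro potential_step_constI[where l = l and v' = 0]) (auto simp: step found_iff[OF step(2)] l_def)
  next
    case False
    have live: "n < N \<or> n < H j"
    proof (rule ccontr)
      assume "\<not> ?thesis"
      then have "n = H j" using assms(2) by auto
      then have "0 \<le> dir n * x" "\<bar>x\<bar> \<le> ?R" using hit[of j] by auto
      moreover from this have "dir n * x = \<bar>x\<bar>" by (auto simp: dir_def abs_if minus_one_power_iff split: if_splits)
      ultimately show False using False x0 by auto
    qed
    let ?v = "?R + (3 + 2 * B) * \<eta> * ?R + 7 * \<eta> + D n j"
    have bd: "bound (step alg x w S) ?v" for w
      using False x0 live step[of w] by (intro bound.attempt) (auto simp: l_def)
    have "\<eta> * 1 \<le> \<eta> * ?R" using R \<eta> by (intro mult_left_mono) auto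
    moreover have "(2 + (11 + 2 * B) * \<eta>) * ?R = 2 * ?R + (3 + 2 * B) * \<eta> * ?R + 8 * (\<eta> * ?R)"
      by (simp add: algebra_simps)
    ultimately have "l + \<eta> + ?v \<le> Q n j"
      using Q_step[OF live] l(2) by linarith
    then show ?thesis
      using bd bound_nonneg[OF bd] by (intro potential_step_constI[where l = l and v' = ?v]) (auto simp: step)
  qed
qed

lemma attempt_step:
  assumes "tracks S (n, j, Attempt y)" and live: "n < N \<or> n < H j"
    and pos: "position S = (\<lambda>a. dir n * split_pos Agent1 y y a)"
    and "heading S = (\<lambda>a. dir n * split_pos Agent1 1 1 a)"
    and y: "radius n j \<le> y" and x: "\<not> (0 \<le> dir n * x \<and> dir n * x \<le> y)"
  shows "progresses S (y + (3 + 2 * B) * \<eta> * radius n j + 7 * \<eta> + D n j)"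
proof -
  define \<delta> where "\<delta> = \<eta> * radius n j"
  have R: "1 \<le> radius n j" by (rule radius_ge_1)
  have "\<eta> * radius n j < 1 * radius n j" using \<eta> R by (intro mult_strict_right_mono) auto
  then have \<delta>: "0 < \<delta>" "\<delta> < y" using \<eta> R y unfolding \<delta>_def by (simp, linarith)
  have y0: "0 < y" using R y by linarith
  define l where "l = (if y < dir n * x \<and> dir n * x \<le> y + \<delta> then dir n * x - y else \<delta>)"
  have l: "0 < l" "l \<le> \<delta>" using \<delta> by (auto simp: l_def)
  have *: "clock (step alg x w S) = clock S + l \<and>
    position (step alg x w S) = (\<lambda>a. dir n * split_pos Agent1 (y + 1 * l) (y + 1 * l) a) \<and>
    heading (step alg x w S) = (\<lambda>a. dir n * split_pos Agent1 (1) (1) a) \<and>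
    tracks (step alg x w S) (advance (l) (contacts x (\<lambda>a. dir n * split_pos Agent1 (y + 1 * l) (y + 1 * l) a)) (n, j, Attempt y))" if "fault w Agent1" for w
    by (rule step_zigzag[OF assms(1) command_of.simps(2) assms(3,4), folded \<delta>_def]) (use that \<delta> x y0 in \<open>auto simp: l_def split: if_splits\<close>)
  have fail: "clock (step alg x w S) = clock S + l"
    "position (step alg x w S) = (\<lambda>a. dir n * split_pos Agent1 (y + 1 * l) (y + 1 * l) a)"
    "heading (step alg x w S) = (\<lambda>a. dir n * split_pos Agent1 (1) (1) a)"
    "tracks (step alg x w S) (n, bump n j, Attempt (y + l))" if "fault w Agent1" for w
    using *[of w] that l by auto
  have *: "clock (step alg x w S) = clock S + l \<and>
    position (step alg x w S) = (\<lambda>a. dir n * split_pos Agent1 (y + - 1 * l) (y + 1 * l) a) \<and>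
    heading (step alg x w S) = (\<lambda>a. dir n * split_pos Agent1 (- 1) (1) a) \<and>
    tracks (step alg x w S) (advance (l) (contacts x (\<lambda>a. dir n * split_pos Agent1 (y + - 1 * l) (y + 1 * l) a)) (n, j, Attempt y))" if "\<not> fault w Agent1" for w
    by (rule step_zigzag[OF assms(1) command_of.simps(2) assms(3,4), folded \<delta>_def]) (use that \<delta> x y0 in \<open>auto simp: l_def split: if_splits\<close>)
  have succ: "clock (step alg x w S) = clock S + l"
    "position (step alg x w S) = (\<lambda>a. dir n * split_pos Agent1 (y + - 1 * l) (y + 1 * l) a)"
    "heading (step alg x w S) = (\<lambda>a. dir n * split_pos Agent1 (- 1) (1) a)"
    "tracks (step alg x w S) (n, j, Regroup (y - l) (2 * l) (2 * l))" if "\<not> fault w Agent1" for w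
    using *[of w] that l by auto
  let ?V = "\<lambda>y j. y + (3 + 2 * B) * \<eta> * radius n j + 7 * \<eta> + D n j"
  define v' where "v' = (\<lambda>b. if b then if y < dir n * x \<and> dir n * x \<le> y + \<delta> then 0 else ?V (y + \<delta>) (bump n j)
    else B * (2 * l) + 4 * \<eta> + (y - l + \<eta> + Q (Suc n) j))"
  \<comment> \<open>The counter changes only on levels below \<open>N\<close>, where the first
    disjunct holds.\<close>
  have live': "n < N \<or> n < H (bump n j)" using live by (auto simp: bump_def)
  have bT: "found x (step alg x w S) \<or> bound (step alg x w S) (v' True)" if "fault w Agent1" for w
  proof (cases "y < dir n * x \<and> dir n * x \<le> y + \<delta>")
    case True
    then show ?thesis unfolding found_iff[OF fail(2)[OF that]] by (simp add: l_def)
  next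
    case False
    then have "bound (step alg x w S) (?V (y + \<delta>) (bump n j))"
      using fail[OF that] live' y x \<delta> by (intro bound.attempt) (auto simp: l_def)
    then show ?thesis unfolding v'_def if_P[OF TrueI] if_not_P[OF False] by blast
  qed
  have bF: "bound (step alg x w S) (v' False)" if "\<not> fault w Agent1" for w
  proof -
    have "bound (step alg x w S) (B * (2 * l) + 4 * \<eta> + (y - l + \<eta> + Q (Suc n) j))"
      using succ[OF that] live l \<delta> x by (intro bound.regroup) (auto simp: add.commute)
    then show ?thesis by (simp add: v'_def)
  qed
  have V0: "0 \<le> ?V (y + \<delta>) (bump n j)"
    using \<eta> \<delta> B_ge_0 R D_nonneg y0 by (intro add_nonneg_nonneg mult_nonneg_nonneg) auto
  have pB: "0 \<le> B * l" "B * l \<le> B * \<delta>" using B_ge_0 l by (auto intro: mult_left_mono)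
  have "l + \<eta> + v' True \<le> \<delta> + \<eta> + ?V (y + \<delta>) (bump n j)"
    using V0 l unfolding v'_def by auto
  then have T: "l + \<eta> + v' True \<le> 2 * \<delta> + y + (3 + 2 * B) * \<delta> + 8 * \<eta> + D n (bump n j)"
    unfolding radius_bump by (simp add: \<delta>_def)
  have F: "l + \<eta> + v' False \<le> 2 * (B * \<delta>) + y + 6 * \<eta> + Q (Suc n) j"
    using pB unfolding v'_def by simp
  have "p * (l + \<eta> + v' True) + (1 - p) * (l + \<eta> + v' False) \<le>
      p * (2 * \<delta> + y + (3 + 2 * B) * \<delta> + 8 * \<eta> + D n (bump n j)) +
      (1 - p) * (2 * (B * \<delta>) + y + 6 * \<eta> + Q (Suc n) j)"
    using p by (intro add_mono[OF mult_left_mono[OF T] mult_left_mono[OF F]]) auto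
  \<comment> \<open>Apart from the premise on \<open>D\<close>, what remains is
    \<open>5 * p * \<delta> \<le> 3 * \<delta>\<close> and
    \<open>2 * p * \<eta> \<le> \<eta>\<close>, both from \<open>p < 1 / 2\<close>.\<close>
  also have "\<dots> \<le> y + (3 + 2 * B) * \<delta> + 7 * \<eta> + D n j"
  proof -
    have "0 \<le> (1 - 2 * p) * \<delta>" "0 \<le> (1 - 2 * p) * \<eta>" using p \<delta> \<eta> by auto
    then show ?thesis using D[of n j] \<delta>(1) by (simp only: algebra_simps)
  qed
  finally have ineq: "p * (l + \<eta> + v' True) + (1 - p) * (l + \<eta> + v' False) \<le> y + (3 + 2 * B) * \<eta> * radius n j + 7 * \<eta> + D n j"
    by (simp add: \<delta>_def mult.assoc)
  show ?thesis
  proof (rule potential_stepI[where a = Agent1 and l = "\<lambda>_. l" and v' = v'])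
    show "clock (step alg x w S) - clock S \<le> l" for w
      using fail(1)[of w] succ(1)[of w] by (cases "fault w Agent1") auto
    show "found x (step alg x w S) \<or> bound (step alg x w S) (v' (fault w Agent1))" for w
      using bT[of w] bF[of w] by (cases "fault w Agent1") auto
    show "0 \<le> v' True" using V0 by (simp add: v'_def)
    have "0 \<le> y - l" using l \<delta> by linarith
    then show "0 \<le> v' False"
      using pB \<eta> Q_nonneg[of "Suc n" j] by (simp add: v'_def)
  qed (rule ineq)
qed

lemma regroup_step:
  assumes "tracks S (n, j, Regroup z d d)" and live: "n < N \<or> n < H j"
    and pos: "position S = (\<lambda>a. dir n * split_pos Agent1 z (z + d) a)"
    and "heading S = (\<lambda>a. dir n * split_pos Agent1 (- 1) 1 a)"
    and z: "0 < z" "0 < d" and x: "\<not> (0 \<le> dir n * x \<and> dir n * x \<le> z)"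
  shows "progresses S (B * d + 4 * \<eta> + (z + \<eta> + Q (Suc n) j))"
proof -
  let ?W = "z + \<eta> + Q (Suc n) j"
  have W: "0 \<le> ?W" using z \<eta> Q_nonneg[of "Suc n" j] by simp
  define l where "l = (\<lambda>b. if b then (if z + d < dir n * x \<and> dir n * x \<le> z + 2 * d then dir n * x - (z + d) else d)
    else (if z < dir n * x \<and> dir n * x < z + d then z + d - dir n * x else d))"
  have l: "0 < l b" "l b \<le> d" for b using z by (auto simp: l_def)
  define k where "k = (\<lambda>b. if b then 1 else - 1 :: real)"
  have step: "clock (step alg x w S) = clock S + l b \<and>
    position (step alg x w S) = (\<lambda>a. dir n * split_pos Agent1 (z + 0 * l b) (z + d + k b * l b) a) \<and>
    heading (step alg x w S) = (\<lambda>a. dir n * split_pos Agent1 (- 1) (k b) a) \<and>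
    tracks (step alg x w S) (advance (l b) (contacts x (\<lambda>a. dir n * split_pos Agent1 (z + 0 * l b) (z + d + k b * l b) a))
      (n, j, Regroup z d d))" if "fault w Agent2 = b" for w b
    by (rule step_zigzag[OF assms(1) command_of.simps(3) assms(3,4)])
      (use that z x l[of b] in \<open>auto simp: l_def k_def split: if_splits\<close>)
  \<comment> \<open>If the target cuts the phase short, the remaining walk \<open>d - l\<close> and
    one further surcharge are added.\<close>
  define v' where "v' = (\<lambda>b. if b then (if l True < d then d - l True + \<eta> else 0) + (B * (2 * d) + 4 * \<eta> + ?W)
    else (if l False < d then d - l False + \<eta> else 0) + ?W)"
  have bT: "bound (step alg x w S) (v' True)" if "fault w Agent2 = True" for w
  proof (cases "l True < d")
    case True
    then have "tracks (step alg x w S) (n, j, Regroup z d (d - l True))"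
      using step[OF that] l[of True] z by (auto simp: k_def)
    then have "bound (step alg x w S) (d - l True + \<eta> + (B * (2 * d) + 4 * \<eta> + ?W))"
      using True step[OF that] live z l[of True] by (intro bound.recede) (auto simp: k_def l_def split: if_splits)
    then show ?thesis using True by (simp add: v'_def)
  next
    case False
    then have ld: "l True = d" using l(2)[of True] by simp
    then have "tracks (step alg x w S) (n, j, Regroup z (2 * d) (2 * d))"
      using step[OF that] z by (auto simp: k_def)
    then have "bound (step alg x w S) (B * (2 * d) + 4 * \<eta> + ?W)"
      using step[OF that] live z ld x by (intro bound.regroup) (auto simp: k_def add.commute)
    then show ?thesis using ld by (simp add: v'_def)
  qed
  have bF: "bound (step alg x w S) (v' False)" if "fault w Agent2 = False" for w
  proof (cases "l False < d")
    case True
    then have "tracks (step alg x w S) (n, j, Regroup z d (d - l False))"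
      using step[OF that] l[of False] z by (auto simp: k_def)
    then have "bound (step alg x w S) (d - l False + \<eta> + ?W)"
      using True step[OF that] live z l[of False] by (intro bound.approach) (auto simp: k_def l_def split: if_splits)
    then show ?thesis using True by (simp add: v'_def)
  next
    case False
    then have ld: "l False = d" using l(2)[of False] by simp
    then have "tracks (step alg x w S) (n, j, Back z)"
      using step[OF that] z by (auto simp: k_def)
    then have "bound (step alg x w S) ?W"
      using step[OF that] live z ld x by (intro bound.return) (auto simp: k_def)
    then show ?thesis using ld by (simp add: v'_def)
  qed
  have "l True + \<eta> + v' True \<le> d + 2 * \<eta> + (B * (2 * d) + 4 * \<eta> + ?W)"
    using \<eta> l[of True] unfolding v'_def by (cases "l True < d") simp_all
  moreover have "l False + \<eta> + v' False \<le> d + 2 * \<eta> + ?W"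
    using \<eta> l[of False] unfolding v'_def by (cases "l False < d") simp_all
  ultimately have "p * (l True + \<eta> + v' True) + (1 - p) * (l False + \<eta> + v' False) \<le>
      p * (d + 2 * \<eta> + (B * (2 * d) + 4 * \<eta> + ?W)) + (1 - p) * (d + 2 * \<eta> + ?W)"
    using p by (intro add_mono[OF mult_left_mono mult_left_mono]) auto
  also have "\<dots> = (1 + 2 * p * B) * d + 2 * \<eta> + 4 * (p * \<eta>) + ?W"
    by (simp add: algebra_simps)
  also have "\<dots> \<le> B * d + 4 * \<eta> + ?W"
    using B_eq p \<eta> mult_right_mono[of p "1 / 2" \<eta>] by simp
  finally have ineq: "p * (l True + \<eta> + v' True) + (1 - p) * (l False + \<eta> + v' False) \<le> B * d + 4 * \<eta> + ?W" .
  show ?thesis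
  proof (rule potential_stepI[where a = Agent2 and l = l and v' = v'])
    show "found x (step alg x w S) \<or> bound (step alg x w S) (v' (fault w Agent2))" for w
      using bT[of w] bF[of w] by (cases "fault w Agent2") auto
    have "0 \<le> B * (2 * d) + 4 * \<eta> + ?W" using B_ge_0 \<eta> z by (intro add_nonneg_nonneg[OF _ W]) auto
    moreover have "0 \<le> (if l b < d then d - l b + \<eta> else 0)" for b using \<eta> by simp
    ultimately show "0 \<le> v' True" "0 \<le> v' False"
      using W unfolding v'_def by (simp_all only: if_True if_False add_nonneg_nonneg)
  qed (use step[OF refl] ineq in auto)
qed

lemma approach_step:
  assumes "tracks S (n, j, Regroup z d r)" and live: "n < N \<or> n < H j"
    and pos: "position S = (\<lambda>a. dir n * split_pos Agent1 z (z + r) a)"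
    and "heading S = (\<lambda>a. dir n * split_pos Agent1 (- 1) (- 1) a)"
    and z: "0 < z" "0 < r" "r < d" and x: "dir n * x = z + r"
  shows "progresses S (r + \<eta> + (z + \<eta> + Q (Suc n) j))"
proof -
  have *: "clock (step alg x w S) = clock S + r \<and>
    position (step alg x w S) = (\<lambda>a. dir n * split_pos Agent1 (z + 0 * r) (z + r + - 1 * r) a) \<and>
    heading (step alg x w S) = (\<lambda>a. dir n * split_pos Agent1 (- 1) (- 1) a) \<and>
    tracks (step alg x w S) (advance (r) (contacts x (\<lambda>a. dir n * split_pos Agent1 (z + 0 * r) (z + r + - 1 * r) a)) (n, j, Regroup z d r))" for w
    by (rule step_zigzag[OF assms(1) command_of.simps(3) assms(3,4)]) (use z x in \<open>auto split: if_splits\<close>)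
  have step: "clock (step alg x w S) = clock S + r"
    "position (step alg x w S) = (\<lambda>a. dir n * split_pos Agent1 (z + 0 * r) (z + r + - 1 * r) a)"
    "heading (step alg x w S) = (\<lambda>a. dir n * split_pos Agent1 (- 1) (- 1) a)"
    "tracks (step alg x w S) (n, j, Back z)" for w
    using *[of w] by auto
  have "bound (step alg x w S) (z + \<eta> + Q (Suc n) j)" for w
    using step[of w] live z x by (intro bound.return) auto
  then show ?thesis
    using z \<eta> Q_nonneg by (intro potential_step_constI[where l = r and v' = "z + \<eta> + Q (Suc n) j"]) (auto simp: step)
qed

lemma recede_step:
  assumes "tracks S (n, j, Regroup z d r)" and live: "n < N \<or> n < H j"
    and pos: "position S = (\<lambda>a. dir n * split_pos Agent1 z (z + 2 * d - r) a)"
    and "heading S = (\<lambda>a. dir n * split_pos Agent1 (- 1) 1 a)"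
    and z: "0 < z" "0 < r" "r < d" and x: "dir n * x = z + 2 * d - r"
  shows "progresses S (r + \<eta> + (B * (2 * d) + 4 * \<eta> + (z + \<eta> + Q (Suc n) j)))"
proof -
  have *: "clock (step alg x w S) = clock S + r \<and>
    position (step alg x w S) = (\<lambda>a. dir n * split_pos Agent1 (z + 0 * r) (z + 2 * d - r + 1 * r) a) \<and>
    heading (step alg x w S) = (\<lambda>a. dir n * split_pos Agent1 (- 1) (1) a) \<and>
    tracks (step alg x w S) (advance (r) (contacts x (\<lambda>a. dir n * split_pos Agent1 (z + 0 * r) (z + 2 * d - r + 1 * r) a)) (n, j, Regroup z d r))" for w
    by (rule step_zigzag[OF assms(1) command_of.simps(3) assms(3,4)]) (use z x in \<open>auto split: if_splits\<close>)
  have step: "clock (step alg x w S) = clock S + r"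
    "position (step alg x w S) = (\<lambda>a. dir n * split_pos Agent1 (z + 0 * r) (z + 2 * d - r + 1 * r) a)"
    "heading (step alg x w S) = (\<lambda>a. dir n * split_pos Agent1 (- 1) (1) a)"
    "tracks (step alg x w S) (n, j, Regroup z (2 * d) (2 * d))" for w
    using *[of w] z by auto
  have "bound (step alg x w S) (B * (2 * d) + 4 * \<eta> + (z + \<eta> + Q (Suc n) j))" for w
    using step[of w] live z x by (intro bound.regroup) auto
  then show ?thesis
    using z \<eta> Q_nonneg B_ge_0
    by (intro potential_step_constI[where l = r and v' = "B * (2 * d) + 4 * \<eta> + (z + \<eta> + Q (Suc n) j)"])
      (auto simp: step intro!: add_nonneg_nonneg)
qed

lemma return_step:
  assumes "tracks S (n, j, Back z)" and live: "n < N \<or> n < H j"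
    and pos: "position S = (\<lambda>a. dir n * split_pos Agent1 z z a)"
    and "heading S = (\<lambda>a. dir n * split_pos Agent1 (- 1) (- 1) a)"
    and z: "0 < z" and x: "\<not> (0 \<le> dir n * x \<and> dir n * x \<le> z)"
  shows "progresses S (z + \<eta> + Q (Suc n) j)"
proof -
  have *: "clock (step alg x w S) = clock S + z \<and>
    position (step alg x w S) = (\<lambda>a. dir n * split_pos Agent1 (z + - 1 * z) (z + - 1 * z) a) \<and>
    heading (step alg x w S) = (\<lambda>a. dir n * split_pos Agent1 (- 1) (- 1) a) \<and>
    tracks (step alg x w S) (advance (z) (contacts x (\<lambda>a. dir n * split_pos Agent1 (z + - 1 * z) (z + - 1 * z) a)) (n, j, Back z))" for w
    by (rule step_zigzag[OF assms(1) command_of.simps(4) assms(3,4)]) (use z x in \<open>auto split: if_splits\<close>)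
  have step: "clock (step alg x w S) = clock S + z"
    "position (step alg x w S) = (\<lambda>a. dir n * split_pos Agent1 (z + - 1 * z) (z + - 1 * z) a)"
    "heading (step alg x w S) = (\<lambda>a. dir n * split_pos Agent1 (- 1) (- 1) a)"
    "tracks (step alg x w S) (Suc n, j, Out)" for w
    using *[of w] by auto
  have "Suc n < N \<or> Suc n \<le> H j" using live N_le_H[of j] by linarith
  then have "bound (step alg x w S) (Q (Suc n) j)" for w
    using step[of w] by (intro bound.out) (auto simp: split_pos_def)
  then show ?thesis
    using z \<eta> Q_nonneg by (intro potential_step_constI[where l = z and v' = "Q (Suc n) j"]) (auto simp: step)
qed

lemma expected_search_time: "expected_search_time p alg x \<le> ennreal (Q 0 0)"
proof (rule expected_search_time_le[where G = bound])
  show "progresses S v" if "bound S v" "\<not> found x S" for S v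
    using that(1)
  proof cases
    case out
    then show ?thesis using that(2) by (simp only:) (rule out_step)
  next
    case attempt
    then show ?thesis by (simp only:) (rule attempt_step)
  next
    case regroup
    then show ?thesis by (simp only:) (rule regroup_step)
  next
    case approach
    then show ?thesis by (simp only:) (rule approach_step)
  next
    case recede
    then show ?thesis by (simp only:) (rule recede_step)
  next
    case return
    then show ?thesis by (simp only:) (rule return_step)
  qed
  have "0 < N \<or> 0 \<le> H 0" by simp
  then have "bound (initial alg x) (Q 0 0)"
    by (intro bound.out) (auto simp: initial_def tracks_def alg_def split_pos_def dir_def)
  then show "found x (initial alg x) \<or> bound (initial alg x) (Q 0 0)" ..
qed (use p \<eta> valid_alg Q_nonneg in auto)

end

section \<open>Repeated averaging\<close>

lemma sum_periodic_shift:
  fixes f :: "nat \<Rightarrow> 'a::ab_group_add"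
  assumes "\<And>j. f (j + L) = f j"
  shows "(\<Sum>k<L. f (j + k)) = (\<Sum>k<L. f k)"
proof (induction j)
  case (Suc j)
  have "f j + (\<Sum>k<L. f (j + Suc k)) = (\<Sum>k<L. f (j + k)) + f (j + L)"
    using sum.lessThan_Suc_shift[of "\<lambda>k. f (j + k)" L] sum.lessThan_Suc[of "\<lambda>k. f (j + k)" L] by simp
  then show ?case using Suc assms by simp
qed simp

text \<open>One round models one level of radius 1: \<open>a\<close> is its cost, \<open>w\<close>
  the distribution modulo \<open>L\<close> of the failures on it, and \<open>r\<close> the number of
  such levels still to come.\<close>

primrec smooth :: "(nat \<Rightarrow> real) \<Rightarrow> nat \<Rightarrow> real \<Rightarrow> (nat \<Rightarrow> real) \<Rightarrow> nat \<Rightarrow> nat \<Rightarrow> real" where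
  "smooth w L a f 0 j = f j"
| "smooth w L a f (Suc r) j = a + (\<Sum>k<L. w k * smooth w L a f r (j + k))"

lemma smooth_periodic:
  assumes "\<And>j. f (j + L) = f j"
  shows "smooth w L a f r (j + L) = smooth w L a f r j"
proof (induction r arbitrary: j)
  case (Suc r)
  have "smooth w L a f r (j + L + k) = smooth w L a f r (j + k)" for k
    using Suc[of "j + k"] by (simp add: add_ac)
  then show ?case by simp
qed (use assms in simp)

lemma smooth_nonneg:
  assumes "0 \<le> a" "\<And>j. 0 \<le> f j" "\<And>k. k < L \<Longrightarrow> 0 \<le> w k"
  shows "0 \<le> smooth w L a f r j"
  using assms by (induction r arbitrary: j) (auto intro!: add_nonneg_nonneg sum_nonneg)

text \<open>
  Part \<open>\<alpha>\<close> of every weight contributes to an exact average; the rest, of total weight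
  \<open>1 - L * \<alpha>\<close>, contracts the deviation from the average.
\<close>

lemma smooth_le:
  fixes f :: "nat \<Rightarrow> real"
  assumes f: "\<And>j. f (j + L) = f j" "\<And>j. f j \<le> A + X"
    and A: "(\<Sum>k<L. f k) = real L * A"
    and w: "\<And>k. k < L \<Longrightarrow> \<alpha> \<le> w k" "(\<Sum>k<L. w k) = 1"
  shows "smooth w L a f r j \<le> real r * a + A + (1 - real L * \<alpha>) ^ r * X"
proof -
  note shift = sum_periodic_shift[where f = "smooth w L a f r" for r, OF smooth_periodic, OF f(1)]
  \<comment> \<open>The weights sum to 1, so a round shifts the mean over a full period by exactly
    \<open>a\<close>.\<close>
  have avg: "(\<Sum>k<L. smooth w L a f r k) = real L * (real r * a + A)" for r
  proof (induction r)
    case (Suc r)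
    have "(\<Sum>j<L. \<Sum>k<L. w k * smooth w L a f r (j + k)) =
        (\<Sum>k<L. w k * (\<Sum>j<L. smooth w L a f r (k + j)))"
      by (subst sum.swap) (simp add: sum_distrib_left add.commute)
    also have "\<dots> = (\<Sum>k<L. w k * (real L * (real r * a + A)))"
      using shift Suc by simp
    also have "\<dots> = real L * (real r * a + A)"
      using w(2) by (simp flip: sum_distrib_right)
    finally show ?case by (simp add: sum.distrib algebra_simps)
  qed (use A in simp)
  show ?thesis
  proof (induction r arbitrary: j)
    case (Suc r)
    let ?b = "real r * a + A + (1 - real L * \<alpha>) ^ r * X"
    let ?g = "smooth w L a f r"
    have "(\<Sum>k<L. w k * ?g (j + k)) = \<alpha> * (\<Sum>k<L. ?g (j + k)) + (\<Sum>k<L. (w k - \<alpha>) * ?g (j + k))"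
      by (simp add: sum_distrib_left algebra_simps flip: sum.distrib)
    also have "(\<Sum>k<L. ?g (j + k)) = real L * (real r * a + A)"
      using shift avg by simp
    also have "(\<Sum>k<L. (w k - \<alpha>) * ?g (j + k)) \<le> (\<Sum>k<L. (w k - \<alpha>) * ?b)"
      using w(1) Suc by (intro sum_mono mult_left_mono) auto
    also have "\<dots> = (1 - real L * \<alpha>) * ?b"
      using w(2) by (simp add: sum_subtractf flip: sum_distrib_right)
    finally show ?case by (simp add: algebra_simps)
  qed (use f in simp)
qed

text \<open>The distribution modulo \<open>L\<close> of the number of failures before the first successful turn.\<close>

definition geo_weight :: "real \<Rightarrow> nat \<Rightarrow> nat \<Rightarrow> real" where
  "geo_weight p L k = (1 - p) * p ^ k / (1 - p ^ L)"

text \<open>Conditioning on the first attempt: a failure moves \<open>j\<close> to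
  \<open>Suc j\<close>, a success keeps it. Periodicity folds the term \<open>k = L\<close> back to
  \<open>k = 0\<close>. This yields the premise on \<open>D\<close> in the potential
  argument.\<close>

lemma geo_weight_recurrence:
  fixes f :: "nat \<Rightarrow> real"
  assumes p: "0 \<le> p" "p < 1" and L: "0 < L" and f: "f (j + L) = f j"
  shows "p * (\<Sum>k<L. geo_weight p L k * f (Suc j + k)) + (1 - p) * f j =
    (\<Sum>k<L. geo_weight p L k * f (j + k))"
proof -
  have pL: "p ^ L < 1" using p L by (simp add: power_less_one_iff)
  let ?g = "\<lambda>k. p ^ k * f (j + k)"
  have "f j + p * (\<Sum>k<L. p ^ k * f (Suc j + k)) = (\<Sum>k<Suc L. ?g k)"
    by (subst sum.lessThan_Suc_shift) (simp add: sum_distrib_left mult.assoc)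
  then have "p * (\<Sum>k<L. p ^ k * f (Suc j + k)) = (\<Sum>k<L. ?g k) - (1 - p ^ L) * f j"
    using f by (simp add: algebra_simps)
  then have "(1 - p) / (1 - p ^ L) * (p * (\<Sum>k<L. p ^ k * f (Suc j + k))) =
      (1 - p) / (1 - p ^ L) * (\<Sum>k<L. ?g k) - (1 - p) * f j"
    using pL by (simp add: right_diff_distrib)
  moreover have "(\<Sum>k<L. geo_weight p L k * h k) = (1 - p) / (1 - p ^ L) * (\<Sum>k<L. p ^ k * h k)" for h
    by (simp add: geo_weight_def sum_distrib_left mult.assoc)
  ultimately show ?thesis by (simp add: mult.left_commute[of p])
qed

lemma sum_geo_weight:
  assumes "0 \<le> p" "p < 1" "0 < L"
  shows "(\<Sum>k<L. geo_weight p L k) = 1"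
proof -
  have "p * (\<Sum>k<L. geo_weight p L k) + (1 - p) = (\<Sum>k<L. geo_weight p L k)"
    using geo_weight_recurrence[OF assms, of "\<lambda>_. 1" 0] by simp
  then have "(1 - p) * (\<Sum>k<L. geo_weight p L k) = (1 - p) * 1" by (simp add: algebra_simps)
  then show ?thesis using assms by simp
qed

lemma geo_weight_mono:
  assumes "0 \<le> p" "p < 1" "k < L"
  shows "geo_weight p L (L - 1) \<le> geo_weight p L k"
  using assms unfolding geo_weight_def
  by (intro divide_right_mono mult_left_mono power_decreasing) (auto simp: power_le_one)

section \<open>The randomized zigzag\<close>

text \<open>
  The turning points of the levels from \<open>N\<close> on are those of the optimal randomized algorithm for one
  agent, discretized: distances grow by a factor \<open>(27/25)^16\<close> per level, and \<open>j\<close> modulo 32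
  determines both the random scale and the random side.
\<close>

locale zigzag_target = zigzag +
  fixes p x :: real
  assumes p: "0 < p" "p < 1 / 2" and even_N: "even N"
begin

definition level_cost :: real where
  "level_cost = 2 + (11 + 2 * (1 / (1 - 2 * p))) * \<eta>"

text \<open>The lower bound 64 exceeds every \<open>j mod 32\<close>, so the subtraction in
  \<open>hit_level\<close> is exact.\<close>

definition scale :: nat where
  "scale = (LEAST e. 64 \<le> e \<and> \<bar>x\<bar> \<le> (27 / 25) ^ e)"

text \<open>The excess over \<open>scale\<close> of the first turning exponent, at least
  \<open>scale\<close>, on the target's side. The summand 16 selects the left side, and
  \<open>31 * scale\<close> stands for \<open>- scale\<close> modulo 32.\<close>

definition offset :: "nat \<Rightarrow> nat" where
  "offset j = (j + ((if 0 \<le> x then 0 else 16) + 31 * scale)) mod 32"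

definition hit_level :: "nat \<Rightarrow> nat" where
  "hit_level j = N + (scale + offset j - j mod 32) div 16"

text \<open>Every level before the hit is paid in full; the hit level costs just the walk to the
  target and one surcharge.\<close>

definition tail :: "nat \<Rightarrow> nat \<Rightarrow> real" where
  "tail n j = \<bar>x\<bar> + \<eta> + level_cost * (\<Sum>i=n..<hit_level j. radius i j)"

abbreviation "w \<equiv> geo_weight p 32"

definition value_at :: "nat \<Rightarrow> nat \<Rightarrow> real" where
  "value_at n j = (if n < N then smooth w 32 level_cost (tail N) (N - n) j else tail n j)"

definition value_after :: "nat \<Rightarrow> nat \<Rightarrow> real" where
  "value_after n j =
     (if n < N then (\<Sum>k<32. w k * value_at (Suc n) (j + k)) else value_at (Suc n) j)"

lemma scale: "64 \<le> scale" "\<bar>x\<bar> \<le> (27 / 25) ^ scale"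
proof -
  obtain e :: nat where e: "\<bar>x\<bar> < (27 / 25) ^ e"
    using real_arch_pow[of "27 / 25" "\<bar>x\<bar>"] by auto
  also have "(27 / 25 :: real) ^ e \<le> (27 / 25) ^ (max 64 e)"
    by (rule power_increasing) auto
  finally have "64 \<le> max 64 e \<and> \<bar>x\<bar> \<le> (27 / 25) ^ max 64 e" by simp
  then have "64 \<le> scale \<and> \<bar>x\<bar> \<le> (27 / 25) ^ scale"
    unfolding scale_def by (rule LeastI)
  then show "64 \<le> scale" "\<bar>x\<bar> \<le> (27 / 25) ^ scale" by auto
qed

lemma scale_le:
  assumes "(27 / 25) ^ 64 < \<bar>x\<bar>"
  shows "(27 / 25) ^ scale \<le> 27 / 25 * \<bar>x\<bar>"
proof -
  have "scale \<noteq> 64" using scale(2) assms by auto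
  then have 64: "64 \<le> scale - 1" "scale = Suc (scale - 1)" using scale(1) by auto
  then have "\<not> (64 \<le> scale - 1 \<and> \<bar>x\<bar> \<le> (27 / 25) ^ (scale - 1))"
    unfolding scale_def by (intro not_less_Least) auto
  then have "(27 / 25) ^ (scale - 1) \<le> \<bar>x\<bar>" using 64 by auto
  then show ?thesis by (subst 64(2)) simp
qed

lemma offset_less: "offset j < 32"
  by (simp add: offset_def)

text \<open>Modulo 32 the difference of \<open>scale + offset j\<close> and \<open>j mod 32\<close>
  is 0 or 16 according to the side of the target. Hence it is a multiple of 16, and the parity of
  the quotient is that side.\<close>

lemma exponent:
  obtains t where "scale + offset j = j mod 32 + 16 * t" "even t \<longleftrightarrow> 0 \<le> x"
    "hit_level j = N + t"
proof -
  have le: "j mod 32 \<le> scale + offset j" using scale(1) mod_less_divisor[of 32 j] by linarith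
  define d where "d = scale + offset j - j mod 32"
  have d: "scale + offset j = j mod 32 + d" using le by (simp add: d_def)
  let ?b = "if 0 \<le> x then 0 else 16 :: nat"
  have eq: "(j mod 32 + d) mod 32 = (j mod 32 + ?b) mod 32"
  proof -
    have "(j mod 32 + d) mod 32 = (scale + (j + (?b + 31 * scale))) mod 32"
      unfolding d[symmetric] offset_def by (simp add: mod_simps)
    also have "scale + (j + (?b + 31 * scale)) = j + ?b + 32 * scale" by simp
    also have "(j + ?b + 32 * scale) mod 32 = (j mod 32 + ?b) mod 32"
      by (simp add: mod_simps)
    finally show ?thesis .
  qed
  have cancel: "((j mod 32 + i) mod 32 + (32 - j mod 32)) mod 32 = i mod 32" for i
  proof -
    have "j mod 32 + i + (32 - j mod 32) = i + 32" using mod_less_divisor[of 32 j] by linarith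
    then show ?thesis unfolding mod_add_left_eq[of "j mod 32 + i"] by (simp only: mod_add_self2)
  qed
  have "d mod 32 = ?b mod 32" using cancel[of d] unfolding eq cancel by (rule sym)
  then have "d = ?b + 32 * (d div 32)" using mod_mult_div_eq[of d 32] by simp
  then obtain k where k: "d = ?b + 32 * k" by blast
  have "d = 16 * (d div 16) \<and> (even (d div 16) \<longleftrightarrow> 0 \<le> x)"
    unfolding k by (cases "0 \<le> x") auto
  moreover have "hit_level j = N + d div 16" by (simp add: hit_level_def d_def)
  ultimately show ?thesis using d by (intro that[of "d div 16"]) simp_all
qed

lemma radius_ge_N: "radius (N + i) j = (27 / 25) ^ (j mod 32 + 16 * i)"
  by (simp add: radius_def)

lemma level_cost_ge_2: "2 \<le> level_cost"
  using p \<eta> by (simp add: level_cost_def)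

lemma tail_nonneg: "0 \<le> tail n j"
  using \<eta> level_cost_ge_2 radius_ge_1 unfolding tail_def
  by (intro add_nonneg_nonneg mult_nonneg_nonneg sum_nonneg) (auto intro: order_trans[OF zero_le_one])

lemma tail_periodic: "tail n (j + 32) = tail n j"
proof -
  have "offset (j + 32) = offset j"
  proof -
    have "j + 32 + c = j + c + 32" for c :: nat by simp
    then show ?thesis unfolding offset_def by (simp only: mod_add_self2)
  qed
  moreover have "radius i (j + 32) = radius i j" for i by (simp add: radius_def)
  ultimately show ?thesis by (simp add: tail_def hit_level_def)
qed

lemma w_nonneg: "0 \<le> w k"
  using p by (simp add: geo_weight_def power_le_one)

lemma value_at_le_N: "n \<le> N \<Longrightarrow> value_at n j = smooth w 32 level_cost (tail N) (N - n) j"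
  by (auto simp: value_at_def)

lemma value_at_nonneg: "0 \<le> value_at n j"
  using level_cost_ge_2 tail_nonneg w_nonneg by (auto simp: value_at_def intro!: smooth_nonneg)

lemma expected_search_time_le_value: "expected_search_time p alg x \<le> ennreal (value_at 0 0)"
proof -
  interpret zigzag_potential N \<eta> p x value_at value_after hit_level "1 / (1 - 2 * p)"
  proof unfold_locales
    fix n j
    show "0 \<le> p" "p < 1 / 2" "1 / (1 - 2 * p) = 1 / (1 - 2 * p)" using p by auto
    show "0 \<le> value_at n j" by (rule value_at_nonneg)
    show "0 \<le> value_after n j"
      using value_at_nonneg w_nonneg by (auto simp: value_after_def intro!: sum_nonneg)
    show "p * value_after n (bump n j) + (1 - p) * value_at (Suc n) j \<le> value_after n j"
    proof (cases "n < N")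
      case True
      then have "value_at (Suc n) (j + 32) = value_at (Suc n) j"
        using smooth_periodic[of "tail N" 32] tail_periodic by (simp add: value_at_le_N)
      then show ?thesis
        using True p geo_weight_recurrence[of p 32 "value_at (Suc n)" j] by (simp add: value_after_def bump_def)
    next
      case False
      then show ?thesis by (simp add: value_after_def bump_def algebra_simps)
    qed
    show "(2 + (11 + 2 * (1 / (1 - 2 * p))) * \<eta>) * radius n j + value_after n j \<le> value_at n j"
      if "n < N \<or> n < hit_level j"
    proof (cases "n < N")
      case True
      then have "N - n = Suc (N - Suc n)" by simp
      then show ?thesis
        using True by (simp add: value_after_def value_at_le_N radius_def level_cost_def)
    next
      case False
      then have "(\<Sum>i=n..<hit_level j. radius i j) = radius n j + (\<Sum>i=Suc n..<hit_level j. radius i j)"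
        using that by (intro sum.atLeast_Suc_lessThan) auto
      then show ?thesis
        using False unfolding level_cost_def[symmetric]
        by (simp add: value_after_def value_at_def tail_def algebra_simps)
    qed
    show "N \<le> hit_level j" by (simp add: hit_level_def)
    then show "\<bar>x\<bar> + \<eta> \<le> value_at (hit_level j) j"
      by (simp add: value_at_def tail_def)
    obtain t where t: "scale + offset j = j mod 32 + 16 * t" "even t \<longleftrightarrow> 0 \<le> x" "hit_level j = N + t"
      by (rule exponent)
    show "0 \<le> dir (hit_level j) * x"
      using t(2) even_N by (cases "0 \<le> x") (auto simp: t(3) dir_def)
    have "\<bar>x\<bar> \<le> (27 / 25) ^ (scale + offset j)"
      using scale(2) by (rule order_trans) (rule power_increasing, auto)
    then show "\<bar>x\<bar> \<le> radius (hit_level j) j"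
      unfolding t(3) radius_ge_N t(1) .
  qed
  show ?thesis by (rule expected_search_time)
qed

text \<open>The radii before the hit form a geometric progression, so their sum is below the radius
  of the hit level divided by \<open>(27 / 25) ^ 16 - 1\<close>.\<close>

lemma tail_le: "tail N j \<le> \<bar>x\<bar> + \<eta> + level_cost * ((27 / 25) ^ scale * (27 / 25) ^ offset j / ((27 / 25) ^ 16 - 1))"
proof -
  obtain t where t: "scale + offset j = j mod 32 + 16 * t" "even t \<longleftrightarrow> 0 \<le> x" "hit_level j = N + t"
    by (rule exponent)
  define r :: real where "r = (27 / 25) ^ 16"
  have r: "1 < r" by (simp add: r_def)
  have "(\<Sum>i=N..<N + t. radius i j) = (\<Sum>i<t. radius (N + i) j)"
    using sum.shift_bounds_nat_ivl[of "\<lambda>i. radius i j" 0 N t] by (simp add: atLeast0LessThan add.commute)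
  also have "\<dots> = (27 / 25) ^ (j mod 32) * (\<Sum>i<t. r ^ i)"
    by (simp add: radius_ge_N r_def power_add power_mult sum_distrib_left)
  also have "(\<Sum>i<t. r ^ i) = (r ^ t - 1) / (r - 1)"
    using r by (intro geometric_sum) auto
  also have "(27 / 25) ^ (j mod 32) * ((r ^ t - 1) / (r - 1)) \<le> (27 / 25) ^ (j mod 32) * (r ^ t / (r - 1))"
    using r by (intro mult_left_mono divide_right_mono) auto
  also have "\<dots> = (27 / 25) ^ (scale + offset j) / (r - 1)"
    by (simp add: t(1) power_add power_mult r_def)
  finally show ?thesis
    using level_cost_ge_2 unfolding tail_def t(3)
    by (intro add_left_mono mult_left_mono) (auto simp: power_add r_def)
qed

text \<open>\<open>offset\<close> permutes the residues modulo 32, so the average over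
  \<open>j\<close> is the same for every target.\<close>

lemma sum_offset: "(\<Sum>j<32. (27 / 25 :: real) ^ offset j) = ((27 / 25) ^ 32 - 1) / (27 / 25 - 1)"
proof -
  let ?f = "\<lambda>j. (27 / 25 :: real) ^ (j mod 32)"
  have "(\<Sum>j<32. (27 / 25) ^ offset j) = (\<Sum>j<32. ?f (((if 0 \<le> x then 0 else 16) + 31 * scale) + j))"
    unfolding offset_def by (simp only: add.commute)
  also have "\<dots> = (\<Sum>j<32. ?f j)"
    by (rule sum_periodic_shift) simp
  also have "\<dots> = (\<Sum>j<32. (27 / 25) ^ j)" by (intro sum.cong) auto
  also have "\<dots> = ((27 / 25) ^ 32 - 1) / (27 / 25 - 1)" by (rule geometric_sum) auto
  finally show ?thesis .
qed

lemma value_at_0_le: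
  assumes "level_cost \<le> 101 / 50" and "(1 - 32 * w 31) ^ N \<le> 1 / 1000" and "(27 / 25) ^ 64 < \<bar>x\<bar>"
  shows "value_at 0 0 \<le> 3 * real N + 1 + 4.8 * \<bar>x\<bar>"
proof -
  define A where "A = (\<Sum>j<32. tail N j) / 32"
  have x: "1 < \<bar>x\<bar>"
    using assms(3) one_le_power[of "27 / 25 :: real" 64] by linarith
  define c where "c = level_cost * ((27 / 25) ^ scale / ((27 / 25) ^ 16 - 1))"
  have c0: "0 \<le> c" using level_cost_ge_2 by (simp add: c_def)
  have c: "c \<le> 101 / 50 * (27 / 25 * \<bar>x\<bar> / ((27 / 25) ^ 16 - 1))"
    unfolding c_def using assms(1) scale_le[OF assms(3)] level_cost_ge_2
    by (intro mult_mono divide_right_mono) auto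
  have tl: "tail N j \<le> \<bar>x\<bar> + 1 + c * (27 / 25) ^ offset j" for j
    using tail_le[of j] \<eta> by (simp add: c_def)
  have "A \<le> (\<Sum>j<32. \<bar>x\<bar> + 1 + c * (27 / 25) ^ offset j) / 32"
    unfolding A_def by (intro divide_right_mono sum_mono tl) auto
  also have "\<dots> = \<bar>x\<bar> + 1 + c * (((27 / 25) ^ 32 - 1) / (27 / 25 - 1)) / 32"
    by (simp add: sum.distrib sum_offset flip: sum_distrib_left)
  also have "\<dots> \<le> \<bar>x\<bar> + 1 + 101 / 50 * (27 / 25 * \<bar>x\<bar> / ((27 / 25) ^ 16 - 1)) * (((27 / 25) ^ 32 - 1) / (27 / 25 - 1)) / 32"
    using c by (intro add_left_mono divide_right_mono mult_right_mono) auto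
  also have "\<dots> \<le> 1 + 4.78 * \<bar>x\<bar>" by (simp add: field_simps)
  finally have A: "A \<le> 1 + 4.78 * \<bar>x\<bar>" .
  have A0: "0 \<le> A" unfolding A_def using tail_nonneg by (intro divide_nonneg_nonneg sum_nonneg) auto
  \<comment> \<open>A crude bound is enough, since the deviation gets multiplied by the mixing
    factor, at most 1/1000.\<close>
  have X: "tail N j \<le> A + 14 * \<bar>x\<bar>" for j
  proof -
    have "(27 / 25 :: real) ^ offset j \<le> (27 / 25) ^ 32"
      using offset_less[of j] by (intro power_increasing) auto
    then have "c * (27 / 25) ^ offset j \<le> 101 / 50 * (27 / 25 * \<bar>x\<bar> / ((27 / 25) ^ 16 - 1)) * (27 / 25) ^ 32"
      using c c0 by (intro mult_mono) auto
    also have "\<dots> \<le> 12 * \<bar>x\<bar>" by (simp add: field_simps)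
    finally show ?thesis using tl[of j] A0 x by linarith
  qed
  have "value_at 0 0 = smooth w 32 level_cost (tail N) N 0"
    by (simp add: value_at_le_N)
  also have "\<dots> \<le> real N * level_cost + A + (1 - real 32 * w 31) ^ N * (14 * \<bar>x\<bar>)"
    using p tail_periodic X sum_geo_weight[of p 32] geo_weight_mono[of p _ 32]
    by (intro smooth_le) (auto simp: A_def)
  also have "\<dots> \<le> real N * 3 + (1 + 4.78 * \<bar>x\<bar>) + 1 / 1000 * (14 * \<bar>x\<bar>)"
    using assms A by (intro add_mono mult_left_mono mult_right_mono) auto
  also have "\<dots> \<le> 3 * real N + 1 + 4.8 * \<bar>x\<bar>" by simp
  finally show ?thesis .
qed

end

lemma zigzag_search:
  assumes p: "0 < p" "p < 1 / 2"
  shows "\<exists>alg. valid_algorithm alg \<and> solves_search p alg \<and> competitive_ratio p alg \<le> ennreal 4.81"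
proof -
  define B where "B = 1 / (1 - 2 * p)"
  \<comment> \<open>Chosen so that \<open>(11 + 2 * B) * \<eta> = 1 / 50\<close>, that is,
    \<open>level_cost\<close> equals 2.02.\<close>
  define \<eta> where "\<eta> = 1 / (50 * (11 + 2 * B))"
  have B: "0 < B" using p by (simp add: B_def)
  then have \<eta>': "0 < \<eta>" "\<eta> < 1" "(11 + 2 * B) * \<eta> = 1 / 50" by (auto simp: \<eta>_def field_simps)
  define \<mu> where "\<mu> = 1 - 32 * geo_weight p 32 31"
  have "p ^ 32 < 1" using p by (simp add: power_less_one_iff)
  then have "\<mu> < 1" using p by (simp add: \<mu>_def geo_weight_def)
  have "(\<Sum>k<(32 :: nat). geo_weight p 32 31) \<le> (\<Sum>k<32. geo_weight p 32 k)"
    using p geo_weight_mono[of p _ 32] by (intro sum_mono) auto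
  then have "0 \<le> \<mu>" using p by (simp add: \<mu>_def sum_geo_weight)
  obtain n where n: "\<mu> ^ n < 1 / 1000"
    using real_arch_pow_inv[of "1 / 1000" \<mu>] \<open>\<mu> < 1\<close> by auto
  \<comment> \<open>Evenness makes level \<open>N\<close> an excursion to the right, as the parity
    in \<open>exponent\<close> presupposes.\<close>
  define N where "N = 2 * n"
  have "\<mu> ^ N \<le> \<mu> ^ n" using \<open>0 \<le> \<mu>\<close> \<open>\<mu> < 1\<close> by (intro power_decreasing) (auto simp: N_def)
  then have N: "\<mu> ^ N \<le> 1 / 1000" using n by simp
  interpret zigzag N \<eta> by unfold_locales (use \<eta>' in auto)
  have target: "zigzag_target N \<eta> p"
    by unfold_locales (use p in \<open>auto simp: N_def\<close>)
  have "solves_search p alg"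
    by (rule solves_searchI)
      (metis zigzag_target.expected_search_time_le_value[OF target] ennreal_less_top infinity_ennreal_def le_less_trans)
  moreover have "competitive_ratio p alg \<le> ennreal 4.81"
  proof (rule competitive_ratio_leI[where b = "(27 / 25) ^ 64 + 100 * (3 * real N + 1) + 1"])
    fix x :: real
    assume x: "(27 / 25) ^ 64 + 100 * (3 * real N + 1) + 1 \<le> \<bar>x\<bar>"
    have "0 < (27 / 25 :: real) ^ 64" "0 \<le> real N" by simp_all
    then have x': "(27 / 25) ^ 64 < \<bar>x\<bar>" "100 * (3 * real N + 1) \<le> \<bar>x\<bar>" using x by argo+
    have "zigzag_target.value_at N \<eta> p x 0 0 \<le> 3 * real N + 1 + 4.8 * \<bar>x\<bar>"
      using \<eta>'(3) N x' unfolding \<mu>_def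
      by (intro zigzag_target.value_at_0_le[OF target])
        (simp_all add: zigzag_target.level_cost_def[OF target] B_def)
    also have "\<dots> \<le> 4.81 * \<bar>x\<bar>" using x'(2) by simp
    finally show "expected_search_time p alg x \<le> ennreal (4.81 * \<bar>x\<bar>)"
      using zigzag_target.expected_search_time_le_value[OF target] by (meson ennreal_leI order_trans)
  qed
  ultimately show ?thesis using valid_alg by blast
qed

section \<open>Comparison of both ratios with the claimed one\<close>

theorem theorem6:
  fixes p \<epsilon> :: real
  assumes "0 \<le> p" and "p < 1 / 2" and "\<epsilon> > 0"
  shows "\<exists>alg. valid_algorithm alg \<and> solves_search p alg \<and>
           competitive_ratio p alg \<le> ennreal (3 + 4 * sqrt (p * (1 - p)) + \<epsilon>)"
proof (cases "p \<le> 32 / 100")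
  case True
  have "2 + 1 / (1 - 2 * p) \<le> 3 + 4 * sqrt (p * (1 - p))"
  proof -
    \<comment> \<open>The claim after squaring
      \<open>p / (2 * (1 - 2 * p)) \<le> sqrt (p * (1 - p))\<close> and cancelling \<open>p\<close>.
      The left side increases and the right side decreases, so 0.32 is the worst case.\<close>
    have "p \<le> 4 * (1 - 2 * p)\<^sup>2 * (1 - p)"
    proof -
      have "(36 / 100)\<^sup>2 \<le> (1 - 2 * p)\<^sup>2" using True by (intro power_mono) auto
      then have "4 * (36 / 100)\<^sup>2 * (68 / 100) \<le> 4 * (1 - 2 * p)\<^sup>2 * (1 - p)"
        using True by (intro mult_mono) auto
      moreover have "p \<le> 4 * (36 / 100)\<^sup>2 * (68 / 100)" using True by (simp add: power2_eq_square)
      ultimately show ?thesis by (rule order_trans[rotated])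
    qed
    then have "p * p \<le> 4 * (1 - 2 * p)\<^sup>2 * (1 - p) * p"
      using assms(1) by (rule mult_right_mono)
    moreover have "(p / (2 * (1 - 2 * p)))\<^sup>2 = p * p / (4 * (1 - 2 * p)\<^sup>2)"
      by (simp only: power_divide power_mult_distrib power2_eq_square[of p]) simp
    moreover have "0 < 4 * (1 - 2 * p)\<^sup>2" using assms(2) by simp
    ultimately have "(p / (2 * (1 - 2 * p)))\<^sup>2 \<le> p * (1 - p)"
      by (simp only: pos_divide_le_eq mult_ac)
    then have "p / (2 * (1 - 2 * p)) \<le> sqrt (p * (1 - p))"
      by (rule real_le_rsqrt)
    moreover have "1 / (1 - 2 * p) = 1 + 4 * (p / (2 * (1 - 2 * p)))"
      using assms(2) by (simp add: field_simps)
    ultimately show ?thesis by simp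
  qed
  then have "ennreal (2 + 1 / (1 - 2 * p) + \<epsilon>) \<le> ennreal (3 + 4 * sqrt (p * (1 - p)) + \<epsilon>)"
    by (intro ennreal_leI) simp
  then show ?thesis
    using diverge_search[OF assms] valid_diverge by (meson order_trans)
next
  case False
  \<comment> \<open>Expanded, this says that \<open>p * (1 - p)\<close> is at least 0.32 * 0.68 =
    0.2176, which exceeds the square 0.2116 of 0.46.\<close>
  have "(p - 32 / 100) * (68 / 100 - p) \<ge> 0"
    using False assms(2) by (intro mult_nonneg_nonneg) auto
  then have "(46 / 100)\<^sup>2 \<le> p * (1 - p)"
    by (simp add: power2_eq_square algebra_simps)
  then have "46 / 100 \<le> sqrt (p * (1 - p))" by (rule real_le_rsqrt)
  then have "ennreal 4.81 \<le> ennreal (3 + 4 * sqrt (p * (1 - p)) + \<epsilon>)"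
    using assms(3) by (intro ennreal_leI) simp
  then show ?thesis
    using zigzag_search[of p] False assms(2) by (meson not_le order_trans less_trans zero_less_divide_iff zero_less_numeral)
qed

end
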